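(* Let $G$ be a connected semi-balanced directed graph. The number of Jaeger trees of $G$ is independent of the ribbon structure and of the basis; that is, any two choices of a ribbon structure together with a basis for $G$ yield the same number of Jaeger trees.
   Context: A directed graph is an orientation of a finite graph without loops and multiple edges; $\overrightarrow{th}$ denotes an edge with tail $t$ and head $h$, and $xy$ an edge whose orientation is not specified. Connectedness, cycles and spanning trees are meant in the underlying undirected graph. A cycle is semi-balanced if it has the same number of edges going in the two directions around the cycle; a directed graph is semi-balanced if all of its cycles are semi-balanced. A ribbon structure on $G$ is a choice, for each vertex $x$, of a cyclic permutation of the edges incident to $x$; $xy^+$ denotes the edge following $xy$ at $x$, and $yx^+$ the edge following $yx$ at $y$. A basis is a pair $(b_0,b_0b_1)$ where $b_0$ is a vertex and $b_0b_1$ is an edge incident to $b_0$ (with $b_0$ its head or its tail). The tour of a spanning tree $T$ is the sequence of node-edge pairs starting with $(b_0,b_0b_1)$ such that if the current pair is $(x,xy)$ and $xy\notin T$ then the next pair is $(x,xy^+)$, while if $xy\in T$ then the next pair is $(y,yx^+)$; it stops right before $(b_0,b_0b_1)$ would become current again. (Each incident node-edge pair occurs exactly once in the tour.) A spanning tree $T$ is a Jaeger tree if for each edge $\overrightarrow{th}\notin T$ the pair $(t,th)$ precedes the pair $(h,th)$ in the tour of $T$. *)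

theory Defs
  imports "Graph_Theory.Digraph_Component" "HOL-Combinatorics.Orbits"
begin

(* An edge with tail t and head h is the pair (t, h); as there are no antiparallel
   pairs, each edge of the underlying simple graph is represented by exactly one arc. *)
locale oriented_graph = pair_digraph G for G :: "'a pair_pre_digraph" +
  assumes no_antiparallel: "(t, h) \<in> parcs G \<Longrightarrow> (h, t) \<notin> parcs G"

(* A step of an undirected cycle is a pair (x, y) where x is left towards y; the edge
   traversed is the one of (x, y), (y, x) that lies in G. In the symmetric closure, going
   back and forth along one edge is a directed cycle of length 2, hence the length bound.
   For the same reason the library's forest and spanning_tree cannot be used below. *)
definition undirected_cycle :: "'a pair_pre_digraph \<Rightarrow> ('a \<times> 'a) list \<Rightarrow> bool" where
  "undirected_cycle G c \<longleftrightarrow>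
     pre_digraph.cycle (with_proj (mk_symmetric (with_proj G))) c \<and> 3 \<le> length c"

definition semi_balanced :: "'a pair_pre_digraph \<Rightarrow> bool" where
  "semi_balanced G \<longleftrightarrow> (\<forall>c. undirected_cycle G c \<longrightarrow>
     length (filter (\<lambda>(x, y). (x, y) \<in> parcs G) c) =
     length (filter (\<lambda>(x, y). (y, x) \<in> parcs G) c))"

definition undirected_spanning_tree :: "'a pair_pre_digraph \<Rightarrow> ('a \<times> 'a) set \<Rightarrow> bool" where
  "undirected_spanning_tree G T \<longleftrightarrow>
     T \<subseteq> parcs G \<and>
     connected (with_proj \<lparr>pverts = pverts G, parcs = T\<rparr>) \<and>
     (\<nexists>c. undirected_cycle \<lparr>pverts = pverts G, parcs = T\<rparr> c)"

definition incident_arcs :: "'a pair_pre_digraph \<Rightarrow> 'a \<Rightarrow> ('a \<times> 'a) set" where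
  "incident_arcs G x = {e \<in> parcs G. fst e = x \<or> snd e = x}"

(* \<sigma> x e is the edge following e at x. The predicate cyclic_on excludes the empty set,
   which occurs only for isolated vertices. *)
definition ribbon_structure ::
    "'a pair_pre_digraph \<Rightarrow> ('a \<Rightarrow> 'a \<times> 'a \<Rightarrow> 'a \<times> 'a) \<Rightarrow> bool" where
  "ribbon_structure G \<sigma> \<longleftrightarrow> (\<forall>x \<in> pverts G.
     \<sigma> x permutes incident_arcs G x \<and>
     (incident_arcs G x \<noteq> {} \<longrightarrow> cyclic_on (\<sigma> x) (incident_arcs G x)))"

definition is_basis :: "'a pair_pre_digraph \<Rightarrow> 'a \<times> ('a \<times> 'a) \<Rightarrow> bool" where
  "is_basis G b \<longleftrightarrow> fst b \<in> pverts G \<and> snd b \<in> incident_arcs G (fst b)"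

definition other_end :: "'a \<times> 'a \<Rightarrow> 'a \<Rightarrow> 'a" where
  "other_end e x = (if fst e = x then snd e else fst e)"

fun tour_step ::
    "('a \<Rightarrow> 'a \<times> 'a \<Rightarrow> 'a \<times> 'a) \<Rightarrow> ('a \<times> 'a) set \<Rightarrow> 'a \<times> ('a \<times> 'a) \<Rightarrow> 'a \<times> ('a \<times> 'a)" where
  "tour_step \<sigma> T (x, e) =
     (if e \<in> T then (other_end e x, \<sigma> (other_end e x) e) else (x, \<sigma> x e))"

(* funpow_dist1 f b b is the least n > 0 with (f ^^ n) b = b, i.e. the time of first return. *)
definition tour ::
    "('a \<Rightarrow> 'a \<times> 'a \<Rightarrow> 'a \<times> 'a) \<Rightarrow> ('a \<times> 'a) set \<Rightarrow> 'a \<times> ('a \<times> 'a) \<Rightarrow> ('a \<times> ('a \<times> 'a)) list" where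
  "tour \<sigma> T b = map (\<lambda>i. (tour_step \<sigma> T ^^ i) b) [0..<funpow_dist1 (tour_step \<sigma> T) b b]"

definition precedes_in :: "'b list \<Rightarrow> 'b \<Rightarrow> 'b \<Rightarrow> bool" where
  "precedes_in xs p q \<longleftrightarrow> (\<exists>i j. i < j \<and> j < length xs \<and> xs ! i = p \<and> xs ! j = q)"

definition jaeger_tree ::
    "'a pair_pre_digraph \<Rightarrow> ('a \<Rightarrow> 'a \<times> 'a \<Rightarrow> 'a \<times> 'a) \<Rightarrow> 'a \<times> ('a \<times> 'a) \<Rightarrow> ('a \<times> 'a) set \<Rightarrow> bool" where
  "jaeger_tree G \<sigma> b T \<longleftrightarrow>
     undirected_spanning_tree G T \<and>
     (\<forall>t h. (t, h) \<in> parcs G - T \<longrightarrow> precedes_in (tour \<sigma> T b) (t, (t, h)) (h, (t, h)))"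

end

theory Submission
  imports Defs "HOL-Computational_Algebra.Formal_Power_Series"
begin

text \<open>
  Call a function \<open>p\<close> on the vertices a demand if it sums to zero, and say that a spanning tree
  \<open>T\<close> carries \<open>p\<close> if \<open>p\<close> is the net inflow of a strictly positive flow on \<open>T\<close>. Geometrically, \<open>p\<close>
  lies in the interior of the cone spanned by the vectors \<open>1\<^sub>h - 1\<^sub>t\<close> of the arcs of \<open>T\<close>. The flow on
  an arc \<open>e\<close> of \<open>T\<close> is the total demand of the component of \<open>T - e\<close> that contains the head of \<open>e\<close>
  (\<open>tree_flow\<close>).

  The cones of the Jaeger trees dissect the union of the cones of all spanning trees: a generic
  demand carried by some spanning tree is carried by exactly one Jaeger tree.

  \<^item> At most one (\<open>jaeger_cones_disjoint\<close>). Look at the first place where the tours of two Jaeger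
    trees differ. It is a first visit to an arc \<open>e\<close>, made at its tail, where one tree contains \<open>e\<close> and
    the other does not. The fundamental cut of \<open>e\<close> in the first tree needs a positive flow in the
    direction of \<open>e\<close>, whereas all arcs of the second tree that cross it do so in the opposite
    direction.

  \<^item> At least one (\<open>jaeger_cone_exists\<close>). Compare trees lexicographically along their tours, where
    an arc seen from its tail should be left out and an arc seen from its head should be put in. If
    the best tree carrying \<open>p\<close> had a non-tree arc that is first seen from its head, a simplex pivot
    (\<open>pivot\<close>) that brings this arc into the tree would lead to a better tree carrying \<open>p\<close>. Such a
    pivot exists because the fundamental cycle of the arc, being balanced, contains arcs of the
    opposite direction, whose flow can be rerouted.

  Hence the set of generic demands carried by Jaeger trees depends neither on the ribbon structure
  nor on the basis, and it remains to read off the number of cones from this set. A semi-balanced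
  graph has a level function that rises by one along each arc (\<open>level_function\<close>). It cuts each cone
  in a unimodular simplex, so comparing volumes would do. Lattice points do the same job: with \<open>n\<close>
  the number of vertices and \<open>r\<close> a fixed vertex, all demands \<open>n (z - 1\<^sub>r) + 1\<close> with \<open>z\<close> integral of sum
  zero are generic, and recording the tree flow of \<open>z\<close> identifies those \<open>z\<close> of level \<open>N\<close> for which
  \<open>T\<close> carries the demand with the lists of \<open>n - 1\<close> natural numbers of sum \<open>N - k\<close>, where \<open>k\<close> is the
  number of arcs of \<open>T\<close> directed towards \<open>r\<close>. So the generating function over \<open>N\<close> of the
  number of carried points is the sum of \<open>X\<^sup>k\<close> over the Jaeger trees times a nonzero power series that
  depends only on \<open>n\<close> (\<open>jaeger_series\<close>). Cancelling this series and putting \<open>X = 1\<close> gives the number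
  of Jaeger trees.
\<close>

section \<open>Trees and their fundamental cuts\<close>

definition linked :: "('a \<times> 'a) set \<Rightarrow> 'a \<Rightarrow> 'a \<Rightarrow> bool" where
  "linked F u v \<longleftrightarrow> (u, v) \<in> (F \<union> F\<inverse>)\<^sup>*"

definition connects :: "'a set \<Rightarrow> ('a \<times> 'a) set \<Rightarrow> bool" where
  "connects V F \<longleftrightarrow> F \<subseteq> V \<times> V \<and> (\<forall>u\<in>V. \<forall>v\<in>V. linked F u v)"

text \<open>
  Trees are minimally connected arc sets. Asking that every arc is a bridge, rather than that there
  is no cycle, gives direct access to fundamental cuts and lets all arguments about trees run
  without walks.
\<close>

definition is_tree :: "'a set \<Rightarrow> ('a \<times> 'a) set \<Rightarrow> bool" where
  "is_tree V T \<longleftrightarrow> connects V T \<and> (\<forall>e\<in>T. \<not> linked (T - {e}) (fst e) (snd e))"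

definition head_side :: "('a \<times> 'a) set \<Rightarrow> 'a \<times> 'a \<Rightarrow> 'a set" where
  "head_side T e = {v. linked (T - {e}) (snd e) v}"

lemma linked_refl [simp]: "linked F u u"
  by (simp add: linked_def)

lemma linked_sym: "linked F u v \<Longrightarrow> linked F v u"
proof -
  have "sym ((F \<union> F\<inverse>)\<^sup>*)" by (intro sym_rtrancl) (auto simp: sym_def)
  then show "linked F u v \<Longrightarrow> linked F v u" by (auto simp: linked_def dest: symD)
qed

lemma linked_trans [trans]: "linked F u v \<Longrightarrow> linked F v w \<Longrightarrow> linked F u w"
  by (auto simp: linked_def)

lemma linked_arc: "(u, v) \<in> F \<Longrightarrow> linked F u v"
  by (auto simp: linked_def)

lemma linked_least:
  assumes "linked F u v" and "\<And>x y. (x, y) \<in> F \<Longrightarrow> linked F' x y"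
  shows "linked F' u v"
proof -
  from assms(1) have "(u, v) \<in> (F \<union> F\<inverse>)\<^sup>*" by (simp add: linked_def)
  then show ?thesis
  proof (induction rule: rtrancl_induct)
    case (step y z)
    then have "linked F' y z" by (auto dest: assms(2) linked_sym)
    with step.IH show ?case by (rule linked_trans)
  qed simp
qed

lemma linked_mono: "linked F u v \<Longrightarrow> F \<subseteq> F' \<Longrightarrow> linked F' u v"
  by (erule linked_least) (auto intro: linked_arc)

lemma linked_in: "linked F u v \<Longrightarrow> F \<subseteq> V \<times> V \<Longrightarrow> u \<in> V \<Longrightarrow> v \<in> V"
proof -
  assume "linked F u v" "F \<subseteq> V \<times> V" "u \<in> V"
  then have "(u, v) \<in> (F \<union> F\<inverse>)\<^sup>*" by (simp add: linked_def)
  then show "v \<in> V" using \<open>F \<subseteq> V \<times> V\<close> \<open>u \<in> V\<close>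
    by (induction rule: rtrancl_induct) auto
qed

text \<open>
  If a walk from \<open>u\<close> to \<open>v\<close> uses the arc \<open>(a, b)\<close>, then the part after the last use starts at an end
  of that arc.
\<close>

lemma linked_delete:
  assumes "linked F u v"
  shows "linked (F - {(a, b)}) u v \<or> linked (F - {(a, b)}) a v \<or> linked (F - {(a, b)}) b v"
proof -
  from assms have "(u, v) \<in> (F \<union> F\<inverse>)\<^sup>*" by (simp add: linked_def)
  then show ?thesis
  proof (induction rule: rtrancl_induct)
    case (step y z)
    show ?case
    proof (cases "(y, z) = (a, b) \<or> (z, y) = (a, b)")
      case False
      then have "linked (F - {(a, b)}) y z"
        using step.hyps by (auto intro: linked_arc linked_sym)
      then show ?thesis using step.IH by (auto intro: linked_trans)
    qed auto
  qed simp
qed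

lemma connects_exchange:
  assumes "connects V F" "F' \<subseteq> V \<times> V" "\<And>x y. (x, y) \<in> F \<Longrightarrow> linked F' x y"
  shows "connects V F'"
  using assms linked_least[of F _ _ F'] by (auto simp: connects_def)

lemma contains_tree:
  assumes "finite F" "connects V F"
  obtains T where "T \<subseteq> F" "is_tree V T"
proof -
  let ?C = "{T. T \<subseteq> F \<and> connects V T}"
  have "finite ?C" by (rule finite_subset[of _ "Pow F"]) (use assms(1) in auto)
  moreover have "?C \<noteq> {}" using assms by auto
  ultimately have "\<exists>T\<in>?C. \<forall>S\<in>?C. S \<le> T \<longrightarrow> T = S" by (rule finite_has_minimal)
  then obtain T where T: "T \<in> ?C" and minimal: "\<And>S. S \<in> ?C \<Longrightarrow> S \<subseteq> T \<Longrightarrow> T = S"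
    by (elim bexE) simp
  have "\<not> linked (T - {e}) (fst e) (snd e)" if "e \<in> T" for e
  proof
    assume link: "linked (T - {e}) (fst e) (snd e)"
    have "connects V (T - {e})"
    proof (rule connects_exchange)
      show "connects V T" using T by simp
      show "T - {e} \<subseteq> V \<times> V" using T by (auto simp: connects_def)
      fix x y assume "(x, y) \<in> T"
      then show "linked (T - {e}) x y"
        using link by (cases "(x, y) = e") (auto intro: linked_arc)
    qed
    then have "T - {e} \<in> ?C" using T by auto
    from minimal[OF this] show False using that by blast
  qed
  then have "is_tree V T" using T by (simp add: is_tree_def)
  then show thesis using T that[of T] by simp
qed

lemma tree_arcs: "is_tree V T \<Longrightarrow> T \<subseteq> V \<times> V"
  by (simp add: is_tree_def connects_def)

lemma tree_finite: "is_tree V T \<Longrightarrow> finite V \<Longrightarrow> finite T"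
  using tree_arcs finite_subset[of T "V \<times> V"] by blast

lemma snd_head_side [simp]: "snd e \<in> head_side T e"
  by (simp add: head_side_def)

lemma fst_head_side: "is_tree V T \<Longrightarrow> e \<in> T \<Longrightarrow> fst e \<notin> head_side T e"
  by (auto simp: is_tree_def head_side_def dest: linked_sym)

lemma head_side_subset: "is_tree V T \<Longrightarrow> e \<in> T \<Longrightarrow> head_side T e \<subseteq> V"
  using tree_arcs[of V T] linked_in[of "T - {e}" "snd e" _ V]
  by (force simp: head_side_def)

lemma head_side_proper:
  assumes "is_tree V T" "e \<in> T"
  shows "head_side T e \<noteq> {}" "head_side T e \<subset> V"
proof -
  show "head_side T e \<noteq> {}" using snd_head_side by blast
  have "fst e \<in> V" using tree_arcs[OF assms(1)] assms(2) by auto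
  then show "head_side T e \<subset> V"
    using head_side_subset[OF assms] fst_head_side[OF assms] by blast
qed

text \<open>
  An arc other than \<open>e\<close> survives in \<open>T - {e}\<close>, so it does not cross the fundamental cut of \<open>e\<close>.
\<close>

lemma head_side_arc:
  assumes "f \<in> T" "f \<noteq> e"
  shows "fst f \<in> head_side T e \<longleftrightarrow> snd f \<in> head_side T e"
proof -
  have "linked (T - {e}) (fst f) (snd f)"
    using assms by (intro linked_arc) auto
  then show ?thesis
    by (auto simp: head_side_def intro: linked_trans linked_sym)
qed

lemma tail_side:
  assumes "is_tree V T" "e \<in> T" "v \<in> V" "v \<notin> head_side T e"
  shows "linked (T - {e}) (fst e) v"
proof -
  have "fst e \<in> V" using assms(1,2) tree_arcs by force
  then have "linked T (fst e) v" using assms by (auto simp: is_tree_def connects_def)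
  from linked_delete[OF this, of "fst e" "snd e"] assms(4) show ?thesis
    by (auto simp: head_side_def)
qed

section \<open>Flows on a tree\<close>

definition net_inflow :: "('a \<times> 'a \<Rightarrow> int) \<Rightarrow> ('a \<times> 'a) set \<Rightarrow> 'a \<Rightarrow> int" where
  "net_inflow g F v = (\<Sum>e\<in>F. g e * (of_bool (snd e = v) - of_bool (fst e = v)))"

text \<open>
  Summation by parts: inflow paired with a vertex function is flow paired with its differences along
  the arcs. Indicator functions give the balance of a cut, level functions the total flow.
\<close>

lemma sum_weighted_net_inflow:
  assumes "finite V" "F \<subseteq> V \<times> V"
  shows "(\<Sum>v\<in>V. w v * net_inflow g F v) = (\<Sum>e\<in>F. g e * (w (snd e) - w (fst e)))"
proof -
  have "(\<Sum>v\<in>V. w v * net_inflow g F v) =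
      (\<Sum>e\<in>F. \<Sum>v\<in>V. w v * (g e * (of_bool (snd e = v) - of_bool (fst e = v))))"
    unfolding net_inflow_def sum_distrib_left by (rule sum.swap)
  also have "\<dots> = (\<Sum>e\<in>F. g e * (w (snd e) - w (fst e)))"
  proof (rule sum.cong[OF refl])
    fix e assume "e \<in> F"
    then have "fst e \<in> V" "snd e \<in> V" using assms(2) by auto
    have pick: "(\<Sum>v\<in>V. w v * of_bool (x = v)) = w x" if "x \<in> V" for x
    proof -
      have "(\<Sum>v\<in>V. w v * of_bool (x = v)) = (\<Sum>v\<in>V. if x = v then w v else 0)"
        by (rule sum.cong) auto
      then show ?thesis using that assms(1) by (simp add: sum.delta')
    qed
    have "(\<Sum>v\<in>V. w v * (g e * (of_bool (snd e = v) - of_bool (fst e = v)))) =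
        g e * ((\<Sum>v\<in>V. w v * of_bool (snd e = v)) - (\<Sum>v\<in>V. w v * of_bool (fst e = v)))"
      unfolding sum_subtractf[symmetric] sum_distrib_left
      by (rule sum.cong) (auto simp: algebra_simps)
    then show "(\<Sum>v\<in>V. w v * (g e * (of_bool (snd e = v) - of_bool (fst e = v)))) =
        g e * (w (snd e) - w (fst e))"
      using pick[OF \<open>fst e \<in> V\<close>] pick[OF \<open>snd e \<in> V\<close>] by simp
  qed
  finally show ?thesis .
qed

lemma sum_net_inflow:
  assumes "finite V" "F \<subseteq> V \<times> V" "S \<subseteq> V"
  shows "sum (net_inflow g F) S = (\<Sum>e\<in>F. g e * (of_bool (snd e \<in> S) - of_bool (fst e \<in> S)))"
proof -
  have "sum (net_inflow g F) S = (\<Sum>v\<in>V. of_bool (v \<in> S) * net_inflow g F v)"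
    using assms(1,3) by (intro sum.mono_neutral_cong_left) auto
  then show ?thesis using sum_weighted_net_inflow[OF assms(1,2)] by simp
qed

lemma net_inflow_add: "net_inflow (\<lambda>e. g e + h e) F v = net_inflow g F v + net_inflow h F v"
  by (simp add: net_inflow_def sum.distrib distrib_right)

lemma net_inflow_scale: "net_inflow (\<lambda>e. c * g e) F v = c * net_inflow g F v"
  by (simp add: net_inflow_def sum_distrib_left mult.assoc)

lemma net_inflow_unit:
  "finite F \<Longrightarrow> e \<in> F \<Longrightarrow> net_inflow (\<lambda>f. of_bool (f = e)) F v = of_bool (snd e = v) - of_bool (fst e = v)"
proof -
  assume "finite F" "e \<in> F"
  have "net_inflow (\<lambda>f. of_bool (f = e)) F v =
     (\<Sum>f\<in>F. if f = e then of_bool (snd f = v) - of_bool (fst f = v) else 0)"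
    unfolding net_inflow_def by (rule sum.cong) auto
  then show ?thesis using \<open>finite F\<close> \<open>e \<in> F\<close> by (simp add: sum.delta)
qed

lemma flow_between:
  assumes "finite F" "linked F u w"
  obtains g where "\<And>v. net_inflow g F v = of_bool (w = v) - of_bool (u = v)"
proof -
  from assms(2) have "(u, w) \<in> (F \<union> F\<inverse>)\<^sup>*" by (simp add: linked_def)
  then have "\<exists>g. \<forall>v. net_inflow g F v = of_bool (w = v) - of_bool (u = v)"
  proof (induction rule: rtrancl_induct)
    case base
    have "net_inflow (\<lambda>_. 0) F v = of_bool (u = v) - of_bool (u = v)" for v
      by (simp add: net_inflow_def)
    then show ?case by blast
  next
    case (step y z)
    then obtain g where g: "\<And>v. net_inflow g F v = of_bool (y = v) - of_bool (u = v)" by blast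
    obtain e c where e: "e \<in> F" and c: "\<And>v. (c::int) * (of_bool (snd e = v) - of_bool (fst e = v)) =
        of_bool (z = v) - of_bool (y = v)"
    proof (cases "(y, z) \<in> F")
      case True
      then show ?thesis using that[of "(y, z)" 1] by simp
    next
      case False
      then have "(z, y) \<in> F" using step.hyps by auto
      then show ?thesis using that[of "(z, y)" "-1"] by simp
    qed
    have "net_inflow (\<lambda>f. g f + c * of_bool (f = e)) F v = of_bool (z = v) - of_bool (u = v)" for v
      unfolding net_inflow_add net_inflow_scale g net_inflow_unit[OF assms(1) e] c by simp
    then show ?case by blast
  qed
  then show thesis using that by blast
qed

text \<open>
  Every demand is a combination of demands that move one unit from a root to another vertex, and
  such a unit can be sent along a walk.
\<close>

lemma flow_exists:
  assumes "finite V" "connects V F" "sum p V = 0"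
  obtains g where "\<And>v. v \<in> V \<Longrightarrow> p v = net_inflow g F v"
proof (cases "V = {}")
  case True
  then show thesis using that by simp
next
  case False
  then obtain r where r: "r \<in> V" by blast
  have F: "finite F" "F \<subseteq> V \<times> V"
    using assms(1,2) finite_subset[of F "V \<times> V"] by (auto simp: connects_def)
  have "\<exists>g. \<forall>v. net_inflow g F v = of_bool (w = v) - of_bool (r = v)" if "w \<in> V" for w
    using flow_between[OF F(1), of r w] assms(2) r that by (metis connects_def)
  then obtain g where g: "\<And>w v. w \<in> V \<Longrightarrow> net_inflow (g w) F v = of_bool (w = v) - of_bool (r = v)"
    by metis
  let ?h = "\<lambda>e. \<Sum>w\<in>V. p w * g w e"
  have "net_inflow ?h F v = (\<Sum>w\<in>V. p w * net_inflow (g w) F v)" for v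
    unfolding net_inflow_def sum_distrib_left sum_distrib_right mult.assoc by (rule sum.swap)
  also have "(\<Sum>w\<in>V. p w * net_inflow (g w) F v) = p v" if "v \<in> V" for v
  proof -
    have "(\<Sum>w\<in>V. p w * net_inflow (g w) F v) =
        (\<Sum>w\<in>V. (if w = v then p w else 0)) - (\<Sum>w\<in>V. p w) * of_bool (r = v)"
      unfolding sum_distrib_right sum_subtractf[symmetric] by (intro sum.cong) (auto simp: g)
    then show ?thesis using that assms(1,3) by simp
  qed
  finally show thesis using that[of ?h] by simp
qed

text \<open>
  Summing the balances over the head side of \<open>e\<close> leaves only the flow on \<open>e\<close>, the single arc that
  crosses the cut.
\<close>

lemma tree_flow_value:
  assumes "finite V" "is_tree V T" "e \<in> T"
  shows "sum (net_inflow g T) (head_side T e) = g e"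
proof -
  have "sum (net_inflow g T) (head_side T e) =
      (\<Sum>f\<in>T. g f * (of_bool (snd f \<in> head_side T e) - of_bool (fst f \<in> head_side T e)))"
    by (rule sum_net_inflow[OF assms(1) tree_arcs[OF assms(2)] head_side_subset[OF assms(2,3)]])
  also have "\<dots> = (\<Sum>f\<in>T. if f = e then g f else 0)"
  proof (rule sum.cong[OF refl])
    fix f assume "f \<in> T"
    then show "g f * (of_bool (snd f \<in> head_side T e) - of_bool (fst f \<in> head_side T e)) =
        (if f = e then g f else 0)"
      using head_side_arc[of f T e] fst_head_side[OF assms(2,3)] by auto
  qed
  also have "\<dots> = g e" using tree_finite[OF assms(2,1)] assms(3) by (simp add: sum.delta)
  finally show ?thesis .
qed

lemma tree_flow:
  assumes "finite V" "is_tree V T" "sum p V = 0" "v \<in> V"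
  shows "p v = net_inflow (\<lambda>e. sum p (head_side T e)) T v"
proof -
  obtain g where g: "\<And>v. v \<in> V \<Longrightarrow> p v = net_inflow g T v"
    using flow_exists[of V T p] assms by (auto simp: is_tree_def)
  have "sum p (head_side T e) = g e" if "e \<in> T" for e
  proof -
    have "sum p (head_side T e) = sum (net_inflow g T) (head_side T e)"
      using head_side_subset[OF assms(2) that] g by (intro sum.cong) auto
    then show ?thesis using tree_flow_value[OF assms(1,2) that] by simp
  qed
  then have "net_inflow (\<lambda>e. sum p (head_side T e)) T v = net_inflow g T v"
    by (simp add: net_inflow_def)
  then show ?thesis using g assms(4) by simp
qed

lemma tree_unit_flow:
  assumes "finite V" "is_tree V T" "t \<in> V" "h \<in> V" "v \<in> V"
  shows "net_inflow (\<lambda>_. 1) {(t, h)} v =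
    net_inflow (\<lambda>e. of_bool (h \<in> head_side T e) - of_bool (t \<in> head_side T e)) T v"
proof -
  let ?q = "net_inflow (\<lambda>_. 1) {(t, h)}"
  have sum_q: "sum ?q S = of_bool (h \<in> S) - of_bool (t \<in> S)" if "S \<subseteq> V" for S
    using sum_net_inflow[OF assms(1) _ that, of "{(t, h)}"] assms(3,4) by simp
  have "sum ?q V = 0" using sum_q[of V] assms(3,4) by simp
  from tree_flow[OF assms(1,2) this assms(5)]
  have "?q v = net_inflow (\<lambda>e. sum ?q (head_side T e)) T v" .
  also have "\<dots> = net_inflow (\<lambda>e. of_bool (h \<in> head_side T e) - of_bool (t \<in> head_side T e)) T v"
    unfolding net_inflow_def[of _ T] using sum_q head_side_subset[OF assms(2)] by (intro sum.cong) simp_all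
  finally show ?thesis .
qed

text \<open>
  Taking the trace of the identity map on the demands proves this. The demands \<open>1\<^sub>v - 1\<^sub>r\<close> with
  \<open>v \<noteq> r\<close> form a basis. Expanding each of them as a flow on the tree and evaluating it at \<open>v\<close>
  contributes 1 for each \<open>v \<noteq> r\<close>; with the order of summation exchanged, each arc of the tree
  contributes 1.
\<close>

lemma card_tree:
  assumes "finite V" "is_tree V T" "V \<noteq> {}"
  shows "card V = card T + 1"
proof -
  obtain r where r: "r \<in> V" using assms(3) by blast
  let ?c = "\<lambda>v e. of_bool (v \<in> head_side T e) - of_bool (r \<in> head_side T e) :: int"
  have T: "finite T" "T \<subseteq> V \<times> V" using tree_finite[OF assms(2,1)] tree_arcs[OF assms(2)] by blast+
  have "int (card V) - 1 = (\<Sum>v\<in>V. of_bool (v \<noteq> r))"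
  proof -
    have "(\<Sum>v\<in>V. of_bool (v \<noteq> r) :: int) = (\<Sum>v\<in>V - {r}. 1)"
      using assms(1) by (intro sum.mono_neutral_cong_right) auto
    then show ?thesis using r assms by (simp add: of_nat_diff Suc_leI card_gt_0_iff)
  qed
  also have "\<dots> = (\<Sum>v\<in>V. net_inflow (?c v) T v)"
  proof (rule sum.cong[OF refl])
    fix v assume v: "v \<in> V"
    have "net_inflow (?c v) T v = 1 - of_bool (r = v)"
      using tree_unit_flow[OF assms(1,2) r v v, symmetric] by (simp add: net_inflow_def[of _ "{_}"])
    then show "of_bool (v \<noteq> r) = net_inflow (?c v) T v" by auto
  qed
  also have "\<dots> = (\<Sum>e\<in>T. \<Sum>v\<in>V. ?c v e * (of_bool (snd e = v) - of_bool (fst e = v)))"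
    unfolding net_inflow_def by (rule sum.swap)
  also have "\<dots> = (\<Sum>e\<in>T. 1)"
  proof (rule sum.cong[OF refl])
    fix e assume e: "e \<in> T"
    have "(\<Sum>v\<in>V. ?c v e * (of_bool (snd e = v) - of_bool (fst e = v))) =
        (\<Sum>v\<in>V. ?c v e * net_inflow (\<lambda>_. 1) {e} v)"
      by (simp add: net_inflow_def)
    also have "\<dots> = ?c (snd e) e - ?c (fst e) e"
      using sum_weighted_net_inflow[of V "{e}" "\<lambda>v. ?c v e" "\<lambda>_. 1"] assms(1) e T by auto
    also have "\<dots> = 1" using fst_head_side[OF assms(2) e] by simp
    finally show "(\<Sum>v\<in>V. ?c v e * (of_bool (snd e = v) - of_bool (fst e = v))) = 1" .
  qed
  finally show ?thesis by simp
qed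

lemma connects_card_tree:
  assumes "finite V" "V \<noteq> {}" "connects V F" "card V = card F + 1"
  shows "is_tree V F"
proof -
  have "finite F" using assms(1,3) finite_subset[of F "V \<times> V"] by (auto simp: connects_def)
  obtain T where T: "T \<subseteq> F" "is_tree V T" using contains_tree[OF \<open>finite F\<close> assms(3)] by blast
  then have "card T = card F" using card_tree[OF assms(1) T(2) assms(2)] assms(4) by simp
  then have "T = F" using T(1) \<open>finite F\<close> by (simp add: card_subset_eq)
  then show ?thesis using T by simp
qed

text \<open>
  The new arc joins the two components of \<open>T - {f}\<close>, so the result is connected, and it has the
  number of arcs of a tree.
\<close>

lemma tree_exchange:
  assumes "finite V" "is_tree V T" "f \<in> T" "t \<in> V - head_side T f" "h \<in> head_side T f"
  shows "is_tree V (insert (t, h) (T - {f}))"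
proof -
  let ?T = "insert (t, h) (T - {f})"
  have hV: "h \<in> V" using head_side_subset[OF assms(2,3)] assms(5) by blast
  have fin: "finite T" using tree_finite[OF assms(2,1)] .
  have new: "(t, h) \<notin> T - {f}"
    using head_side_arc[of "(t, h)" T f] assms(4,5) by auto
  have conn: "connects V ?T"
  proof (rule connects_exchange)
    show "connects V T" using assms(2) by (simp add: is_tree_def)
    show "?T \<subseteq> V \<times> V" using tree_arcs[OF assms(2)] assms(4) hV by auto
    fix x y assume xy: "(x, y) \<in> T"
    show "linked ?T x y"
    proof (cases "(x, y) = f")
      case False
      then show ?thesis using xy by (intro linked_arc) auto
    next
      case True
      have "linked (T - {f}) x t" using tail_side[OF assms(2,3)] assms(4) True by auto
      moreover have "linked (T - {f}) h y"
        using assms(5) True by (auto simp: head_side_def intro: linked_sym)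
      ultimately have "linked ?T x t" "linked ?T h y" by (auto elim: linked_mono)
      moreover have "linked ?T t h" by (intro linked_arc) auto
      ultimately show ?thesis by (blast intro: linked_trans)
    qed
  qed
  have "card ?T = card T"
    using new fin card_Suc_Diff1[OF fin assms(3)] by simp
  then show ?thesis
    using connects_card_tree[OF assms(1) _ conn] card_tree[OF assms(1,2)] hV by force
qed

section \<open>Cycles and levels\<close>

lemma undirected_cycle_iff:
  "undirected_cycle H c \<longleftrightarrow> (\<exists>u\<in>pverts H. pcas u c u \<and> set c \<subseteq> parcs H \<union> (parcs H)\<inverse> \<and>
     distinct (tl (pawalk_verts u c)) \<and> 3 \<le> length c)"
proof -
  have "parcs (mk_symmetric (with_proj H)) = parcs H \<union> (parcs H)\<inverse>"
    by (auto simp: parcs_mk_symmetric)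
  then show ?thesis
    by (auto simp: undirected_cycle_def pre_digraph.cycle_def pre_digraph.awalk_def
      awalk_verts_with_proj_eq cas_with_proj_eq)
qed

lemma pawalk_verts_conv: "pcas u p v \<Longrightarrow> pawalk_verts u p = map fst p @ [v]"
  by (induction p arbitrary: u) auto

lemma pcas_append: "pcas u (p @ q) v \<longleftrightarrow> (\<exists>w. pcas u p w \<and> pcas w q v)"
  by (induction p arbitrary: u) auto

lemma linked_walk:
  assumes "pcas u p v" "set p \<subseteq> F \<union> F\<inverse>"
  shows "linked F u v"
  using assms
proof (induction p arbitrary: u)
  case (Cons a p)
  then have "linked F (fst a) (snd a)" "linked F (snd a) v"
    by (cases a; auto intro: linked_arc linked_sym)+
  then show ?case using Cons.prems by (auto intro: linked_trans)
qed simp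

text \<open>
  A walk is built backwards from \<open>v\<close>; when it returns to a vertex that it has already met, the
  loop is cut off.
\<close>

lemma simple_path_exists:
  assumes "linked F u v"
  obtains p where "pcas u p v" "set p \<subseteq> F \<union> F\<inverse>" "distinct (map fst p @ [v])"
proof -
  from assms have "(u, v) \<in> (F \<union> F\<inverse>)\<^sup>*" by (simp add: linked_def)
  then have "\<exists>p. pcas u p v \<and> set p \<subseteq> F \<union> F\<inverse> \<and> distinct (map fst p @ [v])"
  proof (induction rule: converse_rtrancl_induct)
    case base
    have "pcas v [] v \<and> set [] \<subseteq> F \<union> F\<inverse> \<and> distinct (map fst [] @ [v])" by simp
    then show ?case by blast
  next
    case (step x y)
    then obtain p where p: "pcas y p v" "set p \<subseteq> F \<union> F\<inverse>" "distinct (map fst p @ [v])" by blast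
    consider "x = v" | "x \<in> fst ` set p" | "x \<noteq> v" "x \<notin> fst ` set p" by blast
    then show ?case
    proof cases
      case 1
      then have "pcas x [] v \<and> set [] \<subseteq> F \<union> F\<inverse> \<and> distinct (map fst [] @ [v])" by simp
      then show ?thesis by blast
    next
      case 2
      then obtain a where "a \<in> set p" "fst a = x" by blast
      then obtain p1 p2 where split: "p = p1 @ a # p2" by (meson split_list)
      then have "pcas x (a # p2) v" using p(1) \<open>fst a = x\<close> by (auto simp: pcas_append)
      moreover have "set (a # p2) \<subseteq> F \<union> F\<inverse>" "distinct (map fst (a # p2) @ [v])"
        using p(2,3) split by auto
      ultimately show ?thesis by blast
    next
      case 3
      then have "pcas x ((x, y) # p) v" "set ((x, y) # p) \<subseteq> F \<union> F\<inverse>"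
        "distinct (map fst ((x, y) # p) @ [v])"
        using p step.hyps by auto
      then show ?thesis by blast
    qed
  qed
  then show thesis using that by blast
qed

text \<open>
  A simple path from the head of an arc back to its tail closes up to a cycle. As the path avoids the
  arc, which has no antiparallel partner, it has at least two steps, so the cycle is long enough to
  count.
\<close>

lemma cycle_through_arc:
  assumes "F \<subseteq> V \<times> V" "(t, h) \<in> F" "t \<noteq> h" "(h, t) \<notin> F" "F' \<subseteq> F - {(t, h)}" "linked F' h t"
  obtains p where "pcas h p t" "set p \<subseteq> F' \<union> F'\<inverse>" "undirected_cycle \<lparr>pverts = V, parcs = F\<rparr> ((t, h) # p)"
proof -
  obtain p where p: "pcas h p t" "set p \<subseteq> F' \<union> F'\<inverse>" "distinct (map fst p @ [t])"
    using simple_path_exists[OF assms(6)] .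
  have "3 \<le> length ((t, h) # p)"
  proof (rule ccontr)
    assume "\<not> ?thesis"
    then have "p = [] \<or> (\<exists>a. p = [a])" by (cases p; cases "tl p") auto
    then have "p = [(h, t)]" using p(1) assms(3) by auto
    then show False using p(2) assms(4,5) by auto
  qed
  moreover have "set ((t, h) # p) \<subseteq> F \<union> F\<inverse>" using p(2) assms(2,5) by auto
  moreover have "t \<in> V" using assms(1,2) by auto
  moreover have "pcas t ((t, h) # p) t" using p(1) by simp
  moreover have "distinct (tl (pawalk_verts t ((t, h) # p)))"
    using p(3) pawalk_verts_conv[OF p(1)] by simp
  ultimately have "undirected_cycle \<lparr>pverts = V, parcs = F\<rparr> ((t, h) # p)"
    unfolding undirected_cycle_iff by (intro bexI[of _ t]) auto
  then show thesis using that p(1,2) by blast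
qed

text \<open>
  The remainder of a cycle of length at least 3 does not use its first edge again, in either
  direction, and therefore still joins the two ends of that edge.
\<close>

lemma cycle_arc_not_bridge:
  assumes "undirected_cycle \<lparr>pverts = V, parcs = F\<rparr> c"
  obtains e where "e \<in> F" "linked (F - {e}) (fst e) (snd e)"
proof -
  obtain x where x: "pcas x c x" "set c \<subseteq> F \<union> F\<inverse>" "distinct (tl (pawalk_verts x c))" "3 \<le> length c"
    using assms unfolding undirected_cycle_iff by auto
  obtain y p where c: "c = (x, y) # p" using x(1,4) by (cases c) auto
  have walk: "pcas y p x" and dist: "distinct (map fst p @ [x])"
    and len: "2 \<le> length p"
    using x c pawalk_verts_conv[of y p x] by auto
  have "x \<notin> fst ` set p" using dist by simp
  then have "(x, y) \<notin> set p" by force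
  have "(y, x) \<notin> set p"
  proof
    assume rev: "(y, x) \<in> set p"
    obtain a b q where p: "p = a # b # q"
      using len by (metis Suc_le_length_iff numeral_2_eq_2)
    have "fst a = y" using walk p by simp
    moreover have "y \<notin> fst ` set (b # q)" using dist p \<open>fst a = y\<close> by simp
    ultimately have "a = (y, x)" using rev p by (metis fst_conv imageI set_ConsD)
    then have "fst b = x" using walk p by simp
    then show False using \<open>x \<notin> fst ` set p\<close> p by simp
  qed
  obtain e where e: "e \<in> F" "e = (x, y) \<or> e = (y, x)" using x(2) c by auto
  have "set p \<subseteq> (F - {e}) \<union> (F - {e})\<inverse>"
    using x(2) c e(2) \<open>(x, y) \<notin> set p\<close> \<open>(y, x) \<notin> set p\<close> by auto
  then have "linked (F - {e}) y x" by (rule linked_walk[OF walk])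
  then have "linked (F - {e}) (fst e) (snd e)" using e(2) by (auto intro: linked_sym)
  then show thesis using that e(1) by blast
qed

lemma connected_iff_connects:
  assumes "F \<subseteq> V \<times> V"
  shows "connected (with_proj \<lparr>pverts = V, parcs = F\<rparr>) \<longleftrightarrow> V \<noteq> {} \<and> connects V F"
proof -
  have arcs: "parcs (mk_symmetric (with_proj \<lparr>pverts = V, parcs = F\<rparr>)) = F \<union> F\<inverse>"
    by (auto simp: parcs_mk_symmetric)
  have "(u, v) \<in> rtrancl_on V (F \<union> F\<inverse>) \<longleftrightarrow> linked F u v" if "u \<in> V" "v \<in> V" for u v
    unfolding linked_def using that assms
    by (auto intro: rtrancl_on_rtranclI rtrancl_consistent_rtrancl_on)
  then show ?thesis
    using assms by (auto simp: connected_def strongly_connected_def reachable_def arcs connects_def)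
qed

definition is_level :: "('a \<times> 'a) set \<Rightarrow> ('a \<Rightarrow> int) \<Rightarrow> bool" where
  "is_level E level \<longleftrightarrow> (\<forall>e\<in>E. level (snd e) = level (fst e) + 1)"

lemma is_level_subset: "is_level E level \<Longrightarrow> F \<subseteq> E \<Longrightarrow> is_level F level"
  by (auto simp: is_level_def)

context oriented_graph
begin

lemma arcs_subset: "parcs G \<subseteq> pverts G \<times> pverts G"
  using arc_fst_in_verts arc_snd_in_verts by force

lemma undirected_spanning_tree_iff:
  assumes "pverts G \<noteq> {}"
  shows "undirected_spanning_tree G T \<longleftrightarrow> T \<subseteq> parcs G \<and> is_tree (pverts G) T"
proof (cases "T \<subseteq> parcs G")
  case True
  then have TV: "T \<subseteq> pverts G \<times> pverts G" using arcs_subset by blast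
  have "(\<nexists>c. undirected_cycle \<lparr>pverts = pverts G, parcs = T\<rparr> c) \<longleftrightarrow>
      (\<forall>e\<in>T. \<not> linked (T - {e}) (fst e) (snd e))"
  proof
    assume acyclic: "\<nexists>c. undirected_cycle \<lparr>pverts = pverts G, parcs = T\<rparr> c"
    show "\<forall>e\<in>T. \<not> linked (T - {e}) (fst e) (snd e)"
    proof (intro ballI notI)
      fix e assume e: "e \<in> T" and link: "linked (T - {e}) (fst e) (snd e)"
      obtain t h where th: "e = (t, h)" by fastforce
      have "t \<noteq> h" using pair_no_loops e True th by force
      moreover have "(h, t) \<notin> T" using no_antiparallel e True th by blast
      moreover have "linked (T - {(t, h)}) h t" using link th by (auto intro: linked_sym)
      ultimately show False
        using cycle_through_arc[OF TV, of t h "T - {(t, h)}"] e th acyclic by blast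
    qed
  next
    assume "\<forall>e\<in>T. \<not> linked (T - {e}) (fst e) (snd e)"
    then show "\<nexists>c. undirected_cycle \<lparr>pverts = pverts G, parcs = T\<rparr> c"
      using cycle_arc_not_bridge[of "pverts G" T] by metis
  qed
  then show ?thesis
    using True connected_iff_connects[OF TV] assms
    by (simp add: undirected_spanning_tree_def is_tree_def)
qed (simp add: undirected_spanning_tree_def)

lemma connected_connects: "connected (with_proj G) \<Longrightarrow> connects (pverts G) (parcs G)"
proof -
  assume "connected (with_proj G)"
  moreover have "G = \<lparr>pverts = pverts G, parcs = parcs G\<rparr>" by simp
  ultimately have "connected (with_proj \<lparr>pverts = pverts G, parcs = parcs G\<rparr>)" by metis
  then show ?thesis unfolding connected_iff_connects[OF arcs_subset] by simp
qed

text \<open>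
  Measure the level along a spanning tree by counting the fundamental cuts with the given vertex on
  the head side. It rises by one along the tree arcs, and the fundamental cycle of any other arc,
  being balanced, forces the same for that arc.
\<close>

lemma level_function:
  assumes "connected (with_proj G)" "semi_balanced G"
  obtains level where "is_level (parcs G) level"
proof -
  let ?V = "pverts G" and ?E = "parcs G"
  obtain T where T: "T \<subseteq> ?E" "is_tree ?V T"
    using contains_tree[OF pair_finite_arcs connected_connects[OF assms(1)]] .
  define level where "level v = (\<Sum>f\<in>T. of_bool (v \<in> head_side T f) :: int)" for v
  have fin: "finite T" using tree_finite[OF T(2) pair_finite_verts] .
  have level_T: "level h = level t + 1" if e: "(t, h) \<in> T" for t h
  proof -
    have "level h - level t = (\<Sum>f\<in>T. if f = (t, h) then 1 else 0)"
      unfolding level_def sum_subtractf[symmetric]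
    proof (rule sum.cong[OF refl])
      fix f assume "f \<in> T"
      then show "of_bool (h \<in> head_side T f) - of_bool (t \<in> head_side T f) =
          (if f = (t, h) then 1 else (0::int))"
        using head_side_arc[OF e, of f] fst_head_side[OF T(2) e] snd_head_side[of "(t, h)" T]
        by auto
    qed
    then show ?thesis using fin e by simp
  qed
  define fwd where "fwd = (\<lambda>(x, y). (x, y) \<in> ?E)"
  define bwd where "bwd = (\<lambda>(x, y). (y, x) \<in> ?E)"
  have dir: "fwd (x, y) \<longleftrightarrow> (x, y) \<in> ?E" "bwd (x, y) \<longleftrightarrow> (y, x) \<in> ?E" for x y
    by (simp_all add: fwd_def bwd_def)
  \<comment> \<open>Along a walk in the tree, the surplus of forward over backward steps is the gain in level.\<close>
  have balance: "int (length (filter fwd p)) -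
      int (length (filter bwd p)) = level v - level u"
    if "pcas u p v" "set p \<subseteq> T \<union> T\<inverse>" for u p v
    using that
  proof (induction p arbitrary: u)
    case (Cons a p)
    obtain y where a: "a = (u, y)" using Cons.prems by (cases a) auto
    have IH: "int (length (filter fwd p)) -
        int (length (filter bwd p)) = level v - level y"
      using Cons.prems a by (intro Cons.IH) auto
    have "(u, y) \<in> T \<or> (y, u) \<in> T" using Cons.prems a by auto
    then show ?case
    proof
      assume "(u, y) \<in> T"
      moreover from this have "(u, y) \<in> ?E" "(y, u) \<notin> ?E" using T(1) no_antiparallel by auto
      ultimately show ?case using IH level_T[of u y] a by (simp add: dir)
    next
      assume "(y, u) \<in> T"
      moreover from this have "(y, u) \<in> ?E" "(u, y) \<notin> ?E" using T(1) no_antiparallel by auto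
      ultimately show ?case using IH level_T[of y u] a by (simp add: dir)
    qed
  qed simp
  have "level h = level t + 1" if e: "(t, h) \<in> ?E" for t h
  proof (cases "(t, h) \<in> T")
    case False
    have V: "t \<in> ?V" "h \<in> ?V" using e arcs_subset by auto
    have "t \<noteq> h" "(h, t) \<notin> ?E" using e pair_no_loops no_antiparallel by force+
    moreover have "linked T h t" using T(2) V by (simp add: is_tree_def connects_def)
    moreover have "T \<subseteq> ?E - {(t, h)}" using T(1) False by auto
    ultimately obtain p where p: "pcas h p t" "set p \<subseteq> T \<union> T\<inverse>"
      "undirected_cycle \<lparr>pverts = ?V, parcs = ?E\<rparr> ((t, h) # p)"
      using cycle_through_arc[OF arcs_subset e] by metis
    moreover have "\<lparr>pverts = ?V, parcs = ?E\<rparr> = G" by simp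
    ultimately have "undirected_cycle G ((t, h) # p)" by metis
    then have "length (filter fwd ((t, h) # p)) =
        length (filter bwd ((t, h) # p))"
      using assms(2) unfolding semi_balanced_def fwd_def bwd_def by blast
    then have "length (filter fwd p) + 1 =
        length (filter bwd p)"
      using e \<open>(h, t) \<notin> ?E\<close> by (simp add: dir)
    then show ?thesis using balance[OF p(1,2)] by linarith
  qed (rule level_T)
  then have "is_level ?E level" by (auto simp: is_level_def)
  then show thesis using that by blast
qed

end

text \<open>
  Each unit of flow on an arc raises the level by one, so pairing a demand with the level function
  gives the total flow that serves it. This is what leaves only finitely many integral demands of a
  fixed level in a cone.
\<close>

lemma level_tree_flow:
  assumes "finite V" "is_tree V T" "is_level T level" "\<And>v. v \<in> V \<Longrightarrow> z v = net_inflow g T v"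
  shows "(\<Sum>v\<in>V. level v * z v) = sum g T"
proof -
  have "(\<Sum>v\<in>V. level v * z v) = (\<Sum>v\<in>V. level v * net_inflow g T v)"
    using assms(4) by (intro sum.cong) auto
  also have "\<dots> = (\<Sum>e\<in>T. g e * (level (snd e) - level (fst e)))"
    by (rule sum_weighted_net_inflow[OF assms(1) tree_arcs[OF assms(2)]])
  also have "\<dots> = sum g T"
    using assms(3) by (intro sum.cong) (auto simp: is_level_def)
  finally show ?thesis .
qed

lemma level_tree_demand:
  assumes "finite V" "is_tree V T" "is_level T level" "sum z V = 0"
  shows "(\<Sum>v\<in>V. level v * z v) = (\<Sum>e\<in>T. sum z (head_side T e))"
  by (rule level_tree_flow[OF assms(1-3)]) (rule tree_flow[OF assms(1,2,4)])

text \<open>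
  The tree flow that sends a unit from \<open>t\<close> to \<open>h\<close> has values in \<open>{-1, 0, 1}\<close> and total 1, so it is
  positive somewhere. In terms of cycles: the fundamental cycle of an arc \<open>(t, h)\<close> contains an arc that
  is traversed against its direction when the cycle follows \<open>(t, h)\<close>.
\<close>

lemma forward_arc_exists:
  assumes "finite V" "is_tree V T" "is_level T level"
    and "t \<in> V" "h \<in> V" "level h = level t + 1"
  obtains f where "f \<in> T" "h \<in> head_side T f" "t \<notin> head_side T f"
proof -
  have "(\<Sum>e\<in>T. of_bool (h \<in> head_side T e) - of_bool (t \<in> head_side T e)) =
      (\<Sum>v\<in>V. level v * net_inflow (\<lambda>_. 1) {(t, h)} v)"
    by (rule level_tree_flow[OF assms(1-3), symmetric]) (rule tree_unit_flow[OF assms(1,2,4,5)])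
  also have "\<dots> = 1"
    using sum_weighted_net_inflow[OF assms(1), of "{(t, h)}" level "\<lambda>_. 1"] assms(4-6) by simp
  finally have total: "(\<Sum>e\<in>T. of_bool (h \<in> head_side T e) - of_bool (t \<in> head_side T e)) = (1 :: int)" .
  have "\<exists>f\<in>T. h \<in> head_side T f \<and> t \<notin> head_side T f"
  proof (rule ccontr)
    assume "\<not> ?thesis"
    then have "(\<Sum>e\<in>T. of_bool (h \<in> head_side T e) - of_bool (t \<in> head_side T e)) \<le> (0 :: int)"
      by (intro sum_nonpos) auto
    then show False using total by simp
  qed
  then show thesis using that by blast
qed

section \<open>Pivoting\<close>

text \<open>
  The sums in question are the values of the tree flow that serves \<open>p\<close>, so this says that \<open>p\<close> lies in
  the interior of the cone of \<open>T\<close>.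
\<close>

definition carries :: "('a \<times> 'a) set \<Rightarrow> ('a \<Rightarrow> int) \<Rightarrow> bool" where
  "carries T p \<longleftrightarrow> (\<forall>e\<in>T. 0 < sum p (head_side T e))"

text \<open>
  A generic demand has no zero flow value on any tree, that is, it avoids the boundaries of all
  cones.
\<close>

definition generic :: "'a set \<Rightarrow> ('a \<Rightarrow> int) \<Rightarrow> bool" where
  "generic V p \<longleftrightarrow> sum p V = 0 \<and> (\<forall>S. S \<noteq> {} \<longrightarrow> S \<subset> V \<longrightarrow> sum p S \<noteq> 0)"

text \<open>
  This is a step of the simplex method. Rerouting the amount \<open>g f\<close> of flow through the new arc changes
  the flow on each tree arc \<open>e\<close> by the multiple \<open>- c e\<close> of that amount with \<open>c e\<close> in \<open>{-1, 0, 1}\<close>, and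
  empties \<open>f\<close>. Since \<open>f\<close> has the least flow among the arcs that lose flow, nothing becomes negative,
  and by genericity nothing on the new tree becomes zero.
\<close>

lemma pivot_feasible:
  assumes V: "finite V" and T: "is_tree V T" "carries T p" and p: "generic V p"
    and th: "t \<in> V" "h \<in> V" "(t, h) \<notin> T"
    and f: "f \<in> T" "h \<in> head_side T f" "t \<notin> head_side T f"
    and least: "\<And>e. e \<in> T \<Longrightarrow> h \<in> head_side T e \<Longrightarrow> t \<notin> head_side T e \<Longrightarrow>
      sum p (head_side T f) \<le> sum p (head_side T e)"
  shows "is_tree V (insert (t, h) (T - {f}))" "carries (insert (t, h) (T - {f})) p"
proof -
  let ?T = "insert (t, h) (T - {f})"
  show tree': "is_tree V ?T" using tree_exchange[OF V T(1) f(1)] th(1) f by blast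
  have fin: "finite T" using tree_finite[OF T(1) V] .
  define c where "c e = (of_bool (h \<in> head_side T e) - of_bool (t \<in> head_side T e) :: int)" for e
  define g where "g e = sum p (head_side T e)" for e
  define g' where "g' e = (if e = (t, h) then g f else g e - g f * c e)" for e
  have flow_p: "p v = net_inflow g T v" if "v \<in> V" for v
    unfolding g_def using tree_flow[OF V T(1) _ that] p by (simp add: generic_def)
  have flow_c: "of_bool (h = v) - of_bool (t = v) = net_inflow c T v" if "v \<in> V" for v
    using tree_unit_flow[OF V T(1) th(1,2) that] by (simp add: c_def[abs_def] net_inflow_def[of _ "{_}"])
  have flow': "p v = net_inflow g' ?T v" if v: "v \<in> V" for v
  proof -
    have "net_inflow g' ?T v = g f * (of_bool (h = v) - of_bool (t = v)) + net_inflow g' (T - {f}) v"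
      using fin th(3) by (simp add: net_inflow_def g'_def)
    also have "net_inflow g' (T - {f}) v = net_inflow (\<lambda>e. g e + (- g f) * c e) T v"
      unfolding net_inflow_def
    proof (rule sum.mono_neutral_cong_left[OF fin])
      show "\<forall>e\<in>T - (T - {f}). (g e + - g f * c e) * (of_bool (snd e = v) - of_bool (fst e = v)) = 0"
        using f by (auto simp: c_def)
      fix e assume "e \<in> T - {f}"
      then have "e \<noteq> (t, h)" using th(3) by blast
      then show "g' e * (of_bool (snd e = v) - of_bool (fst e = v)) =
          (g e + - g f * c e) * (of_bool (snd e = v) - of_bool (fst e = v))"
        by (simp add: g'_def)
    qed auto
    also have "\<dots> = p v - g f * net_inflow c T v"
      unfolding net_inflow_add net_inflow_scale using flow_p[OF v] by simp
    finally show ?thesis using flow_c[OF v] by simp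
  qed
  show "carries ?T p"
    unfolding carries_def
  proof
    fix e assume e: "e \<in> ?T"
    let ?D = "head_side ?T e"
    have DV: "?D \<subseteq> V" using head_side_subset[OF tree' e] .
    have "fst e \<in> V" using e tree_arcs[OF tree'] by auto
    moreover have "fst e \<notin> ?D" using fst_head_side[OF tree' e] .
    ultimately have "?D \<subset> V" using DV by blast
    moreover have "?D \<noteq> {}" using snd_head_side by blast
    ultimately have "sum p ?D \<noteq> 0" using p by (simp add: generic_def)
    moreover have "sum p ?D = sum (net_inflow g' ?T) ?D"
      using DV flow' by (intro sum.cong) auto
    then have "sum p ?D = g' e" using tree_flow_value[OF V tree' e] by simp
    moreover have "0 \<le> g' e"
    proof (cases "e = (t, h)")
      case True
      then show ?thesis using T(2) f(1) by (simp add: g'_def g_def carries_def less_imp_le)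
    next
      case False
      then have eT: "e \<in> T" using e by blast
      have pos: "0 < g e" "0 < g f" using T(2) f(1) eT by (simp_all add: carries_def g_def)
      have "g f \<le> g e" if "c e = 1"
        using least[OF eT] that by (auto simp: c_def g_def of_bool_def split: if_splits)
      moreover have "c e = 1 \<or> c e = 0 \<or> c e = -1" by (auto simp: c_def)
      ultimately show ?thesis using False pos by (auto simp: g'_def)
    qed
    ultimately show "0 < sum p ?D" by simp
  qed
qed

lemma pivot:
  assumes V: "finite V" and T: "is_tree V T" "carries T p" and p: "generic V p"
    and level: "is_level (insert (t, h) T) level" and th: "t \<in> V" "h \<in> V" "(t, h) \<notin> T"
  obtains f where "f \<in> T" "h \<in> head_side T f" "t \<notin> head_side T f"
    "is_tree V (insert (t, h) (T - {f}))" "carries (insert (t, h) (T - {f})) p"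
proof -
  let ?C = "{f \<in> T. h \<in> head_side T f \<and> t \<notin> head_side T f}"
  let ?g = "\<lambda>f. sum p (head_side T f)"
  have "is_level T level" "level h = level t + 1" using level by (auto simp: is_level_def)
  then have "?C \<noteq> {}" using forward_arc_exists[OF V T(1) _ th(1,2)] by blast
  moreover have "finite ?C" using tree_finite[OF T(1) V] by simp
  ultimately obtain f where f: "f \<in> ?C" "\<And>e. e \<in> ?C \<Longrightarrow> ?g f \<le> ?g e"
    using arg_min_if_finite(1)[of ?C ?g] arg_min_least[of ?C _ ?g] by blast
  then show thesis using that[of f] pivot_feasible[OF V T p th] by simp
qed

section \<open>The tour of a spanning tree\<close>

locale toured_graph = oriented_graph G for G :: "'a pair_pre_digraph" +
  fixes \<sigma> :: "'a \<Rightarrow> 'a \<times> 'a \<Rightarrow> 'a \<times> 'a" and b :: "'a \<times> ('a \<times> 'a)"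
  assumes ribbon: "ribbon_structure G \<sigma>" and basis: "is_basis G b"
begin

text \<open>
  The node-edge pairs. One step of the tour is a permutation of them: it first crosses the edge if
  that edge is in the tree (\<open>cross\<close>, an involution), and then moves on to the next edge at the node
  (\<open>turn\<close>).
\<close>

definition corners :: "('a \<times> ('a \<times> 'a)) set" where
  "corners = (SIGMA v:pverts G. incident_arcs G v)"

definition visit :: "('a \<times> 'a) set \<Rightarrow> nat \<Rightarrow> 'a \<times> ('a \<times> 'a)" where
  "visit T i = (tour_step \<sigma> T ^^ i) b"

text \<open>
  The position of a corner in the tour; \<open>bij_betw_visit\<close> makes it well defined when \<open>T\<close> is a spanning tree.
\<close>

definition time :: "('a \<times> 'a) set \<Rightarrow> 'a \<times> ('a \<times> 'a) \<Rightarrow> nat" where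
  "time T = the_inv_into {..<card corners} (visit T)"

definition cross :: "('a \<times> 'a) set \<Rightarrow> 'a \<times> ('a \<times> 'a) \<Rightarrow> 'a \<times> ('a \<times> 'a)" where
  "cross T = (\<lambda>(v, e). (if e \<in> T then other_end e v else v, e))"

definition turn :: "'a \<times> ('a \<times> 'a) \<Rightarrow> 'a \<times> ('a \<times> 'a)" where
  "turn = (\<lambda>(v, e). (v, \<sigma> v e))"

lemma tour_step_eq: "tour_step \<sigma> T p = turn (cross T p)"
  by (cases p) (simp add: turn_def cross_def)

lemma corner_iff: "(v, e) \<in> corners \<longleftrightarrow> e \<in> parcs G \<and> (v = fst e \<or> v = snd e)"
  using arc_fst_in_verts arc_snd_in_verts by (auto simp: corners_def incident_arcs_def)

lemma finite_corners: "finite corners"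
  using pair_finite_verts pair_finite_arcs by (auto simp: corners_def incident_arcs_def)

lemma basis_corner: "b \<in> corners"
  using basis by (cases b) (simp add: is_basis_def corners_def)

lemma other_end_simps:
  "other_end e (fst e) = snd e"
  "e \<in> parcs G \<Longrightarrow> other_end e (snd e) = fst e"
  using pair_no_loops by (force simp: other_end_def)+

lemma other_end_pair:
  "other_end (v, w) v = w"
  "(v, w) \<in> parcs G \<Longrightarrow> other_end (v, w) w = v"
  using other_end_simps[of "(v, w)"] by simp_all

lemma cross_corner: "p \<in> corners \<Longrightarrow> cross T p \<in> corners"
  by (cases p) (auto simp: cross_def corner_iff other_end_pair)

lemma cross_cross: "p \<in> corners \<Longrightarrow> cross T (cross T p) = p"
  by (cases p) (auto simp: cross_def corner_iff other_end_pair)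

lemma turn_corner: "p \<in> corners \<Longrightarrow> turn p \<in> corners"
  using ribbon by (cases p) (auto simp: turn_def corners_def ribbon_structure_def permutes_in_image)

lemma inj_on_turn: "inj_on turn corners"
proof (rule inj_onI)
  fix p q assume pq: "p \<in> corners" "q \<in> corners" "turn p = turn q"
  obtain v e w f where eq: "p = (v, e)" "q = (w, f)" by (metis surj_pair)
  then have "v = w" "\<sigma> v e = \<sigma> v f" using pq(3) by (auto simp: turn_def)
  moreover have "\<sigma> v permutes incident_arcs G v"
    using pq(1) eq(1) ribbon by (auto simp: corners_def ribbon_structure_def)
  ultimately show "p = q" using eq by (auto dest: permutes_inj injD)
qed

lemma step_corner: "p \<in> corners \<Longrightarrow> tour_step \<sigma> T p \<in> corners"
  by (simp add: tour_step_eq cross_corner turn_corner)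

lemma inj_on_step: "inj_on (tour_step \<sigma> T) corners"
proof (rule inj_onI)
  fix p q assume pq: "p \<in> corners" "q \<in> corners" "tour_step \<sigma> T p = tour_step \<sigma> T q"
  then have "cross T p = cross T q"
    using inj_on_turn by (auto simp: tour_step_eq dest!: inj_onD intro: cross_corner)
  then show "p = q" using cross_cross pq(1,2) by metis
qed

lemma visit_0 [simp]: "visit T 0 = b"
  by (simp add: visit_def)

lemma visit_Suc: "visit T (Suc i) = tour_step \<sigma> T (visit T i)"
  by (simp add: visit_def)

lemma visit_corner: "visit T i \<in> corners"
  by (induction i) (simp_all add: basis_corner visit_Suc step_corner)

lemma basis_in_orbit: "b \<in> orbit (tour_step \<sigma> T) b"
proof -
  have "\<not> inj_on (visit T) UNIV"
  proof
    assume "inj_on (visit T) UNIV"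
    moreover have "finite (range (visit T))"
      using visit_corner[of T] by (intro finite_subset[OF _ finite_corners]) blast
    ultimately show False using finite_imageD infinite_UNIV_nat by blast
  qed
  then obtain i j where "i < j" "visit T i = visit T j"
    unfolding inj_on_def by (metis linorder_neqE_nat)
  moreover have "visit T i = visit T (i + d) \<Longrightarrow> visit T d = b" for i d
  proof (induction i)
    case (Suc i)
    then have "visit T i = visit T (i + d)"
      using inj_onD[OF inj_on_step] visit_corner by (auto simp: visit_Suc)
    then show ?case by (rule Suc.IH)
  qed simp
  ultimately have "visit T (j - i) = b" "0 < j - i"
    by (metis le_add_diff_inverse less_imp_le) (simp add: \<open>i < j\<close>)
  then have "b = (tour_step \<sigma> T ^^ (j - i)) b \<and> 0 < j - i" by (simp add: visit_def)
  then show ?thesis unfolding orbit_altdef by blast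
qed

definition period :: "('a \<times> 'a) set \<Rightarrow> nat" where
  "period T = funpow_dist1 (tour_step \<sigma> T) b b"

lemma visit_period: "visit T (period T) = b"
  unfolding visit_def period_def using basis_in_orbit by (rule funpow_dist1_prop)

lemma bij_betw_visit_orbit: "bij_betw (visit T) {..<period T} (orbit (tour_step \<sigma> T) b)"
proof -
  have "inj_on (visit T) {0..<period T}"
    unfolding visit_def[abs_def] period_def using basis_in_orbit by (rule inj_on_funpow_dist1)
  moreover have "orbit (tour_step \<sigma> T) b = visit T ` {0..<period T}"
    unfolding visit_def[abs_def] period_def using basis_in_orbit by (rule orbit_conv_funpow_dist1)
  ultimately show ?thesis by (simp add: bij_betw_def atLeast0LessThan)
qed

lemma orbit_eq_visits: "orbit (tour_step \<sigma> T) b = visit T ` {..<period T}"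
  using bij_betw_visit_orbit[of T] by (simp add: bij_betw_def)

lemma orbit_subset_corners: "orbit (tour_step \<sigma> T) b \<subseteq> corners"
  unfolding orbit_eq_visits by (rule image_subsetI) (rule visit_corner)

text \<open>
  A tour passes from one shore of a fundamental cut to the other only along the arc that defines
  the cut.
\<close>

lemma head_side_step:
  assumes "is_tree (pverts G) T" "T \<subseteq> parcs G" "f \<in> T"
  shows "(fst (visit T (Suc k)) \<in> head_side T f \<longleftrightarrow> fst (visit T k) \<in> head_side T f) \<longleftrightarrow>
    snd (visit T k) \<noteq> f"
proof -
  obtain v e where ve: "visit T k = (v, e)" by (metis surj_pair)
  have "e \<in> parcs G" "v = fst e \<or> v = snd e" using visit_corner[of T k] ve by (auto simp: corner_iff)
  then have "(fst (tour_step \<sigma> T (v, e)) \<in> head_side T f \<longleftrightarrow> v \<in> head_side T f) \<longleftrightarrow> e \<noteq> f"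
    using head_side_arc[of e T f] fst_head_side[OF assms(1,3)] assms(3) other_end_simps[of e]
    by auto
  then show ?thesis by (simp add: visit_Suc ve)
qed

text \<open>
  A closed tour that crosses the fundamental cut of \<open>f\<close> must cross it back, and the only way to do
  so is from the other end of \<open>f\<close>. Otherwise the tour would change shores exactly once.
\<close>

lemma cross_orbit:
  assumes "is_tree (pverts G) T" "T \<subseteq> parcs G" "p \<in> orbit (tour_step \<sigma> T) b"
  shows "cross T p \<in> orbit (tour_step \<sigma> T) b"
proof (rule ccontr)
  assume missed: "cross T p \<notin> orbit (tour_step \<sigma> T) b"
  obtain v f where p: "p = (v, f)" by (metis surj_pair)
  have f: "f \<in> T" using missed assms(3) p by (auto simp: cross_def split: if_splits)
  let ?D = "head_side T f"
  obtain i where i: "i < period T" "visit T i = p"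
    using assms(3) unfolding orbit_eq_visits by (metis imageE lessThan_iff)
  \<comment> \<open>Under the assumption that the other end is missed, the tour meets \<open>f\<close> only at time \<open>i\<close>.\<close>
  have only: "snd (visit T k) = f \<longleftrightarrow> k = i" if k: "k < period T" for k
  proof
    assume "snd (visit T k) = f"
    then obtain w where w: "visit T k = (w, f)" by (metis prod.collapse)
    have "w = fst f \<or> w = snd f" "v = fst f \<or> v = snd f"
      using visit_corner[of T k] visit_corner[of T i] w i(2) p by (auto simp: corner_iff)
    moreover have "f \<in> parcs G" using f assms(2) by blast
    ultimately have "(w, f) = p \<or> (w, f) = cross T p"
      using f p other_end_simps[of f] by (auto simp: cross_def)
    moreover have orb: "visit T k \<in> orbit (tour_step \<sigma> T) b"
      using bij_betw_visit_orbit[of T] k by (auto simp: bij_betw_def)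
    ultimately have "visit T k = visit T i" using missed w i(2) by auto
    then show "k = i"
      using bij_betw_visit_orbit[of T] k i(1) by (auto simp: bij_betw_def inj_on_def)
  qed (simp add: i p)
  have "k \<le> period T \<Longrightarrow> fst (visit T k) \<in> ?D \<longleftrightarrow> (fst b \<in> ?D \<longleftrightarrow> k \<le> i)" for k
  proof (induction k)
    case (Suc k)
    then show ?case using head_side_step[OF assms(1,2) f, of k] only[of k] by auto
  qed simp
  \<comment> \<open>After one period the tour is back at the basis, but now on the opposite shore.\<close>
  from this[of "period T"] show False using i(1) by (simp add: visit_period)
qed

lemma turn_orbit:
  assumes "is_tree (pverts G) T" "T \<subseteq> parcs G" "p \<in> orbit (tour_step \<sigma> T) b"
  shows "turn p \<in> orbit (tour_step \<sigma> T) b"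
proof -
  have "p \<in> corners" using assms(3) orbit_subset_corners[of T] by blast
  then have "turn p = tour_step \<sigma> T (cross T p)" by (simp add: tour_step_eq cross_cross)
  then show ?thesis using orbit.step[OF cross_orbit[OF assms]] by simp
qed

text \<open>
  The orbit of the basis is closed under crossing tree arcs and therefore also under turning. By
  cyclicity of the ribbon structure it contains all corners at a vertex as soon as it contains one,
  and by connectedness of the tree it spreads to all vertices.
\<close>

lemma orbit_corners:
  assumes "is_tree (pverts G) T" "T \<subseteq> parcs G"
  shows "orbit (tour_step \<sigma> T) b = corners"
proof
  let ?O = "orbit (tour_step \<sigma> T) b"
  show sub: "?O \<subseteq> corners" by (rule orbit_subset_corners)
  have around: "(v, e') \<in> ?O" if "(v, e) \<in> ?O" "e' \<in> incident_arcs G v" for v e e'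
  proof -
    have v: "v \<in> pverts G" "e \<in> incident_arcs G v" using that(1) sub by (auto simp: corners_def)
    then have "cyclic_on (\<sigma> v) (incident_arcs G v)"
      using ribbon by (auto simp: ribbon_structure_def)
    then have "e' \<in> orbit (\<sigma> v) e"
      using v(2) that(2) orbit_cyclic_eq3 by metis
    then show ?thesis
    proof (induction rule: orbit.induct)
      case base
      then show ?case using turn_orbit[OF assms that(1)] by (simp add: turn_def)
    next
      case (step e')
      then show ?case using turn_orbit[OF assms, of "(v, e')"] by (simp add: turn_def)
    qed
  qed
  \<comment> \<open>A tree arc \<open>e\<close> carries the orbit from a corner at one of its ends to a corner at the other.\<close>
  have spread: "\<forall>e\<in>incident_arcs G v. (v, e) \<in> ?O" if "linked T (fst b) v" for v
  proof -
    from that have "(fst b, v) \<in> (T \<union> T\<inverse>)\<^sup>*" by (simp add: linked_def)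
    then show ?thesis
    proof (induction rule: rtrancl_induct)
      case base
      have "(fst b, snd b) \<in> ?O" using basis_in_orbit by simp
      then show ?case using around by blast
    next
      case (step v w)
      then obtain e where e: "e \<in> T" "e = (v, w) \<or> e = (w, v)" by auto
      then have E: "e \<in> parcs G" using assms(2) by blast
      then have "e \<in> incident_arcs G v" using e by (auto simp: incident_arcs_def)
      then have "cross T (v, e) \<in> ?O" using step.IH cross_orbit[OF assms] by blast
      moreover have "cross T (v, e) = (w, e)"
        using e other_end_simps(2)[OF E] by (auto simp: cross_def other_end_def)
      ultimately show ?case using around by metis
    qed
  qed
  show "corners \<subseteq> ?O"
  proof
    fix p assume "p \<in> corners"
    then obtain v e where p: "p = (v, e)" "v \<in> pverts G" "e \<in> incident_arcs G v"
      by (auto simp: corners_def)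
    have "fst b \<in> pverts G" using basis by (simp add: is_basis_def)
    then have "linked T (fst b) v" using assms(1) p(2) by (simp add: is_tree_def connects_def)
    then show "p \<in> ?O" using spread p by blast
  qed
qed

lemma
  assumes "is_tree (pverts G) T" "T \<subseteq> parcs G"
  shows period_eq: "period T = card corners"
    and bij_betw_visit: "bij_betw (visit T) {..<card corners} corners"
proof -
  show "period T = card corners"
    using bij_betw_same_card[OF bij_betw_visit_orbit[of T]] orbit_corners[OF assms] by simp
  then show "bij_betw (visit T) {..<card corners} corners"
    using bij_betw_visit_orbit[of T] orbit_corners[OF assms] by simp
qed

context
  fixes T assumes tree: "is_tree (pverts G) T" and sub: "T \<subseteq> parcs G"
begin

lemma visit_time: "p \<in> corners \<Longrightarrow> visit T (time T p) = p"
  using bij_betw_visit[OF tree sub] by (auto simp: time_def bij_betw_def f_the_inv_into_f)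

lemma time_less: "p \<in> corners \<Longrightarrow> time T p < card corners"
  using bij_betw_visit[OF tree sub] the_inv_into_into[of "visit T" "{..<card corners}" p "{..<card corners}"]
  by (auto simp: time_def bij_betw_def)

lemma time_visit: "k < card corners \<Longrightarrow> time T (visit T k) = k"
  using bij_betw_visit[OF tree sub] by (auto simp: time_def bij_betw_def the_inv_into_f_f)

lemma time_eq_iff: "p \<in> corners \<Longrightarrow> q \<in> corners \<Longrightarrow> time T p = time T q \<longleftrightarrow> p = q"
  using visit_time by metis

lemma precedes_in_tour_iff:
  assumes "p \<in> corners" "q \<in> corners"
  shows "precedes_in (tour \<sigma> T b) p q \<longleftrightarrow> time T p < time T q"
proof -
  have "tour \<sigma> T b = map (visit T) [0..<card corners]"
    using period_eq[OF tree sub] by (simp add: tour_def period_def visit_def)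
  then have "precedes_in (tour \<sigma> T b) p q \<longleftrightarrow>
      (\<exists>i j. i < j \<and> j < card corners \<and> visit T i = p \<and> visit T j = q)"
    unfolding precedes_in_def by (intro arg_cong[where f = Ex] ext conj_cong) auto
  also have "\<dots> \<longleftrightarrow> time T p < time T q"
    using assms visit_time time_less time_visit by (metis order.strict_trans)
  finally show ?thesis .
qed

text \<open>
  Since \<open>f\<close> is visited just twice, the tour makes one excursion to the shore of the fundamental
  cut of \<open>f\<close> that avoids the basis. It leaves after the visit at \<open>(x, f)\<close> and returns after the
  visit at \<open>(y, f)\<close>, where \<open>x\<close> is the end of \<open>f\<close> on the shore of the basis. In between it visits all
  corners of the other shore.
\<close>

lemma excursion:
  assumes f: "f \<in> T"
  obtains x y where "x = fst f \<and> y = snd f \<or> x = snd f \<and> y = fst f"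
    and "x \<in> head_side T f \<longleftrightarrow> fst b \<in> head_side T f"
    and "time T (x, f) < time T (y, f)"
    and "\<And>p. p \<in> corners \<Longrightarrow> (fst p \<in> head_side T f \<longleftrightarrow> fst b \<in> head_side T f) \<longleftrightarrow>
      time T p \<le> time T (x, f) \<or> time T (y, f) < time T p"
proof -
  let ?D = "head_side T f"
  have E: "f \<in> parcs G" using f sub by blast
  then have ends: "(fst f, f) \<in> corners" "(snd f, f) \<in> corners" "fst f \<noteq> snd f"
    using pair_no_loops by (auto simp: corner_iff)
  then have "time T (fst f, f) \<noteq> time T (snd f, f)" using time_eq_iff by simp
  then obtain x y where xy: "x = fst f \<and> y = snd f \<or> x = snd f \<and> y = fst f"
    "time T (x, f) < time T (y, f)"
    by (metis linorder_neqE_nat)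
  then have xyc: "(x, f) \<in> corners" "(y, f) \<in> corners" using ends by auto
  have hits: "snd (visit T k) = f \<longleftrightarrow> k = time T (x, f) \<or> k = time T (y, f)"
    if "k < card corners" for k
  proof
    assume "snd (visit T k) = f"
    then have "visit T k = (x, f) \<or> visit T k = (y, f)"
      using visit_corner[of T k] xy(1) by (cases "visit T k") (auto simp: corner_iff)
    then show "k = time T (x, f) \<or> k = time T (y, f)" using time_visit[OF that] by auto
  qed (use visit_time[OF xyc(1)] visit_time[OF xyc(2)] in auto)
  have sides: "k < card corners \<Longrightarrow> (fst (visit T k) \<in> ?D \<longleftrightarrow> fst b \<in> ?D) \<longleftrightarrow>
      k \<le> time T (x, f) \<or> time T (y, f) < k" for k
  proof (induction k)
    case (Suc k)
    then show ?case
      using head_side_step[OF tree sub f, of k] hits[of k] xy(2) by (auto simp: less_Suc_eq_le Suc_le_eq)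
  qed simp
  have key: "(fst p \<in> ?D \<longleftrightarrow> fst b \<in> ?D) \<longleftrightarrow> time T p \<le> time T (x, f) \<or> time T (y, f) < time T p"
    if "p \<in> corners" for p
    using sides[OF time_less[OF that]] visit_time[OF that] by simp
  show thesis
    using that[OF xy(1) _ xy(2) key] key[OF xyc(1)] by simp
qed

end

lemma jaeger_tree_iff:
  "jaeger_tree G \<sigma> b T \<longleftrightarrow> T \<subseteq> parcs G \<and> is_tree (pverts G) T \<and>
     (\<forall>t h. (t, h) \<in> parcs G - T \<longrightarrow> time T (t, (t, h)) < time T (h, (t, h)))"
proof -
  have "pverts G \<noteq> {}" using basis by (auto simp: is_basis_def)
  then show ?thesis
    using precedes_in_tour_iff[of T]
    by (auto simp: jaeger_tree_def undirected_spanning_tree_iff corner_iff)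
qed

text \<open>
  Tours of different trees run in parallel until they meet an arc that belongs to one of the trees
  only; this arc has not been met before.
\<close>

lemma first_difference:
  assumes T: "is_tree (pverts G) T" "T \<subseteq> parcs G"
    and T': "is_tree (pverts G) T'" "T' \<subseteq> parcs G"
    and "T \<noteq> T'"
  obtains k where "k < card corners"
    and "\<And>j. j \<le> k \<Longrightarrow> visit T' j = visit T j"
    and "\<And>j. j < k \<Longrightarrow> snd (visit T j) \<in> T \<longleftrightarrow> snd (visit T j) \<in> T'"
    and "snd (visit T k) \<in> T \<longleftrightarrow> snd (visit T k) \<notin> T'"
proof -
  let ?P = "\<lambda>k. snd (visit T k) \<in> T \<longleftrightarrow> snd (visit T k) \<notin> T'"
  obtain e where e: "e \<in> T \<longleftrightarrow> e \<notin> T'" using assms(5) by blast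
  then have "(fst e, e) \<in> corners" using T(2) T'(2) by (auto simp: corner_iff)
  then have ex: "?P (time T (fst e, e)) \<and> time T (fst e, e) < card corners"
    using e visit_time[OF T] time_less[OF T] by simp
  define k where "k = (LEAST k. ?P k)"
  have "?P (time T (fst e, e))" using ex by blast
  then have "?P k" unfolding k_def by (rule LeastI)
  have least: "\<not> ?P j" if "j < k" for j using that unfolding k_def by (rule not_less_Least)
  have "k < card corners"
    using Least_le[of ?P "time T (fst e, e)"] ex unfolding k_def by linarith
  moreover have "j \<le> k \<Longrightarrow> visit T' j = visit T j" for j
  proof (induction j)
    case (Suc j)
    then have "visit T' j = visit T j" "snd (visit T j) \<in> T \<longleftrightarrow> snd (visit T j) \<in> T'"
      using least[of j] by auto
    then show ?case by (cases "visit T j") (auto simp: visit_Suc)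
  qed simp
  ultimately show thesis using that[of k] \<open>?P k\<close> least by blast
qed

end

section \<open>Cones of Jaeger trees\<close>

lemma binary_tail_less:
  fixes a :: "nat \<Rightarrow> bool"
  assumes "m \<le> n"
  shows "(\<Sum>k=m..<n. of_bool (a k) * 2 ^ (n - Suc k)) < (2 :: nat) ^ (n - m)"
  using assms
proof (induction m rule: inc_induct)
  case (step m)
  have "(\<Sum>k=m..<n. of_bool (a k) * 2 ^ (n - Suc k)) =
      of_bool (a m) * 2 ^ (n - Suc m) + (\<Sum>k=Suc m..<n. of_bool (a k) * (2 :: nat) ^ (n - Suc k))"
    using step.hyps by (intro sum.atLeast_Suc_lessThan) simp
  also have "\<dots> < 2 * 2 ^ (n - Suc m)" using step.IH by (simp add: of_bool_def)
  also have "\<dots> = 2 ^ (n - m)" using step.hyps by (metis Suc_diff_Suc power_Suc)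
  finally show ?case .
qed simp

text \<open>
  Binary numbers compare lexicographically.
\<close>

lemma binary_less:
  fixes a c :: "nat \<Rightarrow> bool"
  assumes "k < n" "\<And>j. j < k \<Longrightarrow> a j = c j" "\<not> a k" "c k"
  shows "(\<Sum>j<n. of_bool (a j) * 2 ^ (n - Suc j)) < (\<Sum>j<n. of_bool (c j) * (2 :: nat) ^ (n - Suc j))"
proof -
  have split: "(\<Sum>j<n. u j) = (\<Sum>j<k. u j) + u k + (\<Sum>j=Suc k..<n. u j)" for u :: "nat \<Rightarrow> nat"
  proof -
    have "(\<Sum>j<n. u j) = (\<Sum>j=0..<k. u j) + (\<Sum>j=k..<n. u j)"
      using sum.atLeastLessThan_concat[of 0 k n u] assms(1) by (simp add: atLeast0LessThan)
    then show ?thesis using assms(1) by (simp add: sum.atLeast_Suc_lessThan atLeast0LessThan)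
  qed
  have "(\<Sum>j<k. of_bool (a j) * 2 ^ (n - Suc j)) = (\<Sum>j<k. of_bool (c j) * (2 :: nat) ^ (n - Suc j))"
    using assms(2) by (intro sum.cong) auto
  then show ?thesis
    using binary_tail_less[of "Suc k" n a] assms(1,3,4) by (simp add: split)
qed

context toured_graph
begin

text \<open>
  The fundamental cut in \<open>T\<close> of the first arc on which the trees differ separates the cones. This
  arc is met from its tail because \<open>T'\<close> is a Jaeger tree. An arc \<open>f\<close> of \<open>T'\<close> that crosses the
  cut is not in \<open>T\<close>, and by agreement of the trees so far it is not seen before the excursion of
  \<open>T\<close> beyond the cut begins. So it is first seen during the excursion, from the far shore; as \<open>T\<close> is a
  Jaeger tree, its tail is there. Hence the flow of \<open>T'\<close> into the far shore is not positive, whereas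
  the flow of \<open>T\<close> into it is.
\<close>

lemma jaeger_cones_separated:
  assumes T: "jaeger_tree G \<sigma> b T" and T': "jaeger_tree G \<sigma> b T'"
    and p: "sum p (pverts G) = 0" "carries T p" "carries T' p"
    and k: "k < card corners" "\<And>j. j \<le> k \<Longrightarrow> visit T' j = visit T j"
      "\<And>j. j < k \<Longrightarrow> snd (visit T j) \<in> T \<longleftrightarrow> snd (visit T j) \<in> T'"
    and e: "snd (visit T k) \<in> T" "snd (visit T k) \<notin> T'"
  shows False
proof -
  note J = T[unfolded jaeger_tree_iff] and J' = T'[unfolded jaeger_tree_iff]
  have tree: "is_tree (pverts G) T" "T \<subseteq> parcs G" using J by auto
  have tree': "is_tree (pverts G) T'" "T' \<subseteq> parcs G" using J' by auto
  obtain t h where th: "snd (visit T k) = (t, h)" by (metis surj_pair)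
  let ?e = "(t, h)" and ?D = "head_side T (t, h)"
  have E: "?e \<in> parcs G" "t \<noteq> h" using e(1) th tree(2) pair_no_loops by force+
  have c: "(t, ?e) \<in> corners" "(h, ?e) \<in> corners" using E by (auto simp: corner_iff)
  \<comment> \<open>Both trees agree on all arcs met before time \<open>k\<close>, so the arc met at time \<open>k\<close> is new.\<close>
  have not_seen: "snd (visit T j) \<noteq> ?e" if "j < k" for j
    using k(3)[OF that] e th by auto
  have "visit T k = (t, ?e) \<or> visit T k = (h, ?e)"
    using visit_corner[of T k] th by (cases "visit T k") (auto simp: corner_iff)
  moreover have "visit T k \<noteq> (h, ?e)"
  proof
    assume "visit T k = (h, ?e)"
    then have "time T' (h, ?e) = k" using k(2)[of k] time_visit[OF tree' k(1)] by simp
    then have less: "time T' (t, ?e) < k" using J' E(1) e(2) th by auto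
    then have "visit T (time T' (t, ?e)) = (t, ?e)"
      using k(2)[of "time T' (t, ?e)"] visit_time[OF tree' c(1)] by simp
    then show False using not_seen[OF less] by simp
  qed
  ultimately have vk: "visit T k = (t, ?e)" by blast
  then have tk: "time T (t, ?e) = k" using time_visit[OF tree k(1)] by simp
  have "\<not> time T (h, ?e) < k" using not_seen[of "time T (h, ?e)"] visit_time[OF tree c(2)] by auto
  then have order: "\<not> time T (h, ?e) < time T (t, ?e)" using tk by simp
  have eT: "?e \<in> T" using e(1) th by simp
  obtain x y where xy: "x = t \<and> y = h \<or> x = h \<and> y = t" "x \<in> ?D \<longleftrightarrow> fst b \<in> ?D"
    "time T (x, ?e) < time T (y, ?e)"
    and sides: "\<And>q. q \<in> corners \<Longrightarrow> (fst q \<in> ?D \<longleftrightarrow> fst b \<in> ?D) \<longleftrightarrow>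
      time T q \<le> time T (x, ?e) \<or> time T (y, ?e) < time T q"
    using excursion[OF tree eT] by (metis fst_conv snd_conv)
  have "x = t" "y = h" using xy(1,3) order by auto
  have tD: "t \<notin> ?D" using fst_head_side[OF tree(1) eT] by simp
  then have bD: "fst b \<notin> ?D" using xy(2) \<open>x = t\<close> by simp
  \<comment> \<open>As seen from the shore \<open>?D\<close> beyond the cut, arcs of \<open>T'\<close> can only lead out.\<close>
  have no_entry: "\<not> (snd f \<in> ?D \<and> fst f \<notin> ?D)" if f: "f \<in> T'" for f
  proof
    assume cr: "snd f \<in> ?D \<and> fst f \<notin> ?D"
    have "f \<noteq> ?e" using f e(2) th by auto
    then have "f \<notin> T" using cr head_side_arc[of f T ?e] by blast
    have fE: "f \<in> parcs G" using f tree'(2) by blast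
    then have fc: "(fst f, f) \<in> corners" "(snd f, f) \<in> corners" by (auto simp: corner_iff)
    have "time T (fst f, f) < time T (snd f, f)"
      using J fE \<open>f \<notin> T\<close> by (cases f) auto
    moreover have "time T (snd f, f) \<le> time T (h, ?e)"
      using sides[OF fc(2)] cr bD \<open>x = t\<close> \<open>y = h\<close> by auto
    moreover have "time T (fst f, f) \<le> time T (t, ?e) \<or> time T (h, ?e) < time T (fst f, f)"
      using sides[OF fc(1)] cr bD \<open>x = t\<close> \<open>y = h\<close> by auto
    ultimately have "time T (fst f, f) \<le> k" using tk by linarith
    moreover have "time T (fst f, f) \<noteq> k"
      using visit_time[OF tree fc(1)] vk \<open>f \<noteq> ?e\<close> by auto
    ultimately have "time T (fst f, f) < k" by simp
    from k(3)[OF this] show False using visit_time[OF tree fc(1)] f \<open>f \<notin> T\<close> by simp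
  qed
  have DV: "?D \<subseteq> pverts G" using head_side_subset[OF tree(1) eT] .
  let ?g = "\<lambda>f. sum p (head_side T' f)"
  have "sum p ?D = sum (net_inflow ?g T') ?D"
    using DV tree_flow[OF pair_finite_verts tree'(1) p(1)] by (intro sum.cong) auto
  also have "\<dots> = (\<Sum>f\<in>T'. ?g f * (of_bool (snd f \<in> ?D) - of_bool (fst f \<in> ?D)))"
    by (rule sum_net_inflow[OF pair_finite_verts tree_arcs[OF tree'(1)] DV])
  also have "\<dots> \<le> 0"
  proof (rule sum_nonpos)
    fix f assume f: "f \<in> T'"
    then have "0 < ?g f" using p(3) by (simp add: carries_def)
    then show "?g f * (of_bool (snd f \<in> ?D) - of_bool (fst f \<in> ?D)) \<le> 0"
      using no_entry[OF f] by (auto simp: of_bool_def)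
  qed
  finally show False using p(2) eT by (auto simp: carries_def)
qed

lemma jaeger_cones_disjoint:
  assumes T: "jaeger_tree G \<sigma> b T" and T': "jaeger_tree G \<sigma> b T'"
    and p: "sum p (pverts G) = 0" "carries T p" "carries T' p"
  shows "T = T'"
proof (rule ccontr)
  assume "T \<noteq> T'"
  have tree: "is_tree (pverts G) T" "T \<subseteq> parcs G" "is_tree (pverts G) T'" "T' \<subseteq> parcs G"
    using T T' by (auto simp: jaeger_tree_iff)
  obtain k where k: "k < card corners"
    "\<And>j. j \<le> k \<Longrightarrow> visit T' j = visit T j"
    "\<And>j. j < k \<Longrightarrow> snd (visit T j) \<in> T \<longleftrightarrow> snd (visit T j) \<in> T'"
    "snd (visit T k) \<in> T \<longleftrightarrow> snd (visit T k) \<notin> T'"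
    using first_difference[OF tree \<open>T \<noteq> T'\<close>] by blast
  show False
  proof (cases "snd (visit T k) \<in> T")
    case True
    then show ?thesis using jaeger_cones_separated[OF T T' p k(1-3)] k(4) by blast
  next
    case False
    then show ?thesis
      using jaeger_cones_separated[OF T' T p(1,3,2) k(1), OF k(2)[symmetric]] k by simp
  qed
qed

text \<open>
  A decision of the tree is favourable if it leaves out an arc that is seen from its tail, or
  contains an arc that is seen from its head. The rank compares the sequences of decisions along the
  tours lexicographically, earlier ones first. A second visit to an arc repeats a decision already
  taken, so it never decides a comparison.
\<close>

definition favourable :: "('a \<times> 'a) set \<Rightarrow> nat \<Rightarrow> bool" where
  "favourable T k \<longleftrightarrow> (fst (visit T k) = fst (snd (visit T k)) \<longleftrightarrow> snd (visit T k) \<notin> T)"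

definition rank :: "('a \<times> 'a) set \<Rightarrow> nat" where
  "rank T = (\<Sum>k<card corners. of_bool (favourable T k) * 2 ^ (card corners - Suc k))"

text \<open>
  A tree of maximal rank among those carrying \<open>p\<close> is a Jaeger tree. Suppose that the arc \<open>(t, h)\<close> is
  left out and first seen from \<open>h\<close>. Pivot it into the tree in exchange for \<open>f\<close>, and consider which
  of the two arcs the tour meets first. If it is \<open>(t, h)\<close>, seen from its head, then putting it in is an
  improvement. If it is \<open>f\<close>, then \<open>f\<close> is seen from its tail, so leaving it out is an improvement: had
  the tour come from the head of \<open>f\<close>, the excursion along \<open>f\<close> would lead to the shore of \<open>t\<close> and meet
  \<open>(t, h)\<close> from \<open>t\<close> before it is met from \<open>h\<close>.
\<close>

lemma jaeger_cone_exists: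
  assumes level: "is_level (parcs G) level"
    and p: "generic (pverts G) p"
    and T0: "is_tree (pverts G) T0" "T0 \<subseteq> parcs G" "carries T0 p"
  obtains T where "jaeger_tree G \<sigma> b T" "carries T p"
proof -
  let ?P = "\<lambda>T. is_tree (pverts G) T \<and> T \<subseteq> parcs G \<and> carries T p"
  have "rank T < 2 ^ card corners" for T
    using binary_tail_less[of 0 "card corners" "favourable T"]
    unfolding rank_def atLeast0LessThan by simp
  then obtain T where T: "?P T" and max: "\<And>T'. ?P T' \<Longrightarrow> rank T' \<le> rank T"
    using ex_has_greatest_nat[of ?P T0 rank "2 ^ card corners"] T0 by blast
  then have tree: "is_tree (pverts G) T" "T \<subseteq> parcs G" "carries T p" by auto
  have "time T (t, (t, h)) < time T (h, (t, h))" if e: "(t, h) \<in> parcs G - T" for t h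
  proof (rule ccontr)
    let ?e = "(t, h)"
    assume "\<not> ?thesis"
    moreover have c: "(t, ?e) \<in> corners" "(h, ?e) \<in> corners" "t \<noteq> h"
      using e pair_no_loops[of ?e] by (auto simp: corner_iff)
    ultimately have late: "time T (h, ?e) < time T (t, ?e)"
      using time_eq_iff[OF tree(1,2) c(1,2)] by (simp add: not_less le_less)
    obtain f where f: "f \<in> T" "h \<in> head_side T f" "t \<notin> head_side T f"
      and T': "is_tree (pverts G) (insert ?e (T - {f}))" "carries (insert ?e (T - {f})) p"
      using pivot[OF pair_finite_verts tree(1,3) p, of t h level] e arcs_subset
        is_level_subset[OF level, of "insert ?e T"] tree(2) by blast
    define T' where "T' = insert ?e (T - {f})"
    have sub': "T' \<subseteq> parcs G" using tree(2) e by (auto simp: T'_def)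
    have "T \<noteq> T'" using e by (auto simp: T'_def)
    then obtain k where k: "k < card corners" "\<And>j. j \<le> k \<Longrightarrow> visit T' j = visit T j"
      "\<And>j. j < k \<Longrightarrow> snd (visit T j) \<in> T \<longleftrightarrow> snd (visit T j) \<in> T'"
      "snd (visit T k) \<in> T \<longleftrightarrow> snd (visit T k) \<notin> T'"
      using first_difference[OF tree(1,2) _ sub'] T'(1) T'_def by blast
    \<comment> \<open>The trees differ exactly on \<open>(t, h)\<close> and \<open>f\<close>, so neither arc is met before time \<open>k\<close>.\<close>
    have unseen: "k \<le> time T (x, d)" if "(x, d) \<in> corners" "d = ?e \<or> d = f" for x d
    proof (rule ccontr)
      assume "\<not> ?thesis"
      then have "d \<in> T \<longleftrightarrow> d \<in> T'"
        using k(3)[of "time T (x, d)"] visit_time[OF tree(1,2) that(1)] by simp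
      then show False using that(2) f(1) e by (auto simp: T'_def)
    qed
    have "f \<noteq> ?e" using f(1) e by blast
    have "snd (visit T k) = ?e \<or> snd (visit T k) = f" using k(4) by (auto simp: T'_def)
    then have "favourable T' k \<and> \<not> favourable T k"
    proof
      assume vk: "snd (visit T k) = ?e"
      have "visit T k \<noteq> (t, ?e)"
        using unseen[OF c(2)] late time_visit[OF tree(1,2) k(1)] by auto
      then have "visit T k = (h, ?e)"
        using visit_corner[of T k] vk by (cases "visit T k") (auto simp: corner_iff)
      then show ?thesis using k(2)[of k] e c(3) by (simp add: favourable_def T'_def)
    next
      assume vk: "snd (visit T k) = f"
      let ?D = "head_side T f"
      have fE: "f \<in> parcs G" using f(1) tree(2) by blast
      then have fc: "(fst f, f) \<in> corners" "(snd f, f) \<in> corners" by (auto simp: corner_iff)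
      \<comment> \<open>If \<open>f\<close> were met at its head, then \<open>t\<close> would lie on the far shore, which is toured before \<open>(t, h)\<close> is seen from \<open>h\<close>.\<close>
      have "visit T k \<noteq> (snd f, f)"
      proof
        assume "visit T k = (snd f, f)"
        then have sk: "time T (snd f, f) = k" using time_visit[OF tree(1,2) k(1)] by metis
        then have early: "time T (snd f, f) \<le> time T (fst f, f)" using unseen[OF fc(1)] by simp
        obtain x y where xy: "x = fst f \<and> y = snd f \<or> x = snd f \<and> y = fst f"
          "x \<in> ?D \<longleftrightarrow> fst b \<in> ?D" "time T (x, f) < time T (y, f)"
          and sides: "\<And>q. q \<in> corners \<Longrightarrow> (fst q \<in> ?D \<longleftrightarrow> fst b \<in> ?D) \<longleftrightarrow>
            time T q \<le> time T (x, f) \<or> time T (y, f) < time T q"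
          using excursion[OF tree(1,2) f(1)] by blast
        have "x = snd f" "y = fst f" using xy(1,3) early by auto
        then have bD: "fst b \<in> ?D" using xy(2) by simp
        have "time T (t, ?e) \<le> time T (y, f)" using sides[OF c(1)] bD f(3) by auto
        moreover have "time T (h, ?e) \<le> time T (x, f) \<or> time T (y, f) < time T (h, ?e)"
          using sides[OF c(2)] bD f(2) by auto
        ultimately have "time T (h, ?e) \<le> k" using late sk \<open>x = snd f\<close> by auto
        then have "time T (h, ?e) = time T (snd f, f)" using unseen[OF c(2)] sk by simp
        then show False using time_eq_iff[OF tree(1,2) c(2) fc(2)] \<open>f \<noteq> ?e\<close> by simp
      qed
      then have "visit T k = (fst f, f)"
        using visit_corner[of T k] vk by (cases "visit T k") (auto simp: corner_iff)
      then show ?thesis using k(2)[of k] f(1) \<open>f \<noteq> ?e\<close> by (simp add: favourable_def T'_def)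
    qed
    moreover have "favourable T j \<longleftrightarrow> favourable T' j" if "j < k" for j
      using k(2)[of j] k(3)[OF that] that by (simp add: favourable_def)
    ultimately have "rank T < rank T'"
      unfolding rank_def using k(1) by (intro binary_less[of k]) auto
    then show False using max[of T'] T' sub' by (simp add: T'_def)
  qed
  then have "jaeger_tree G \<sigma> b T" using tree by (simp add: jaeger_tree_iff)
  then show thesis using that tree(3) by blast
qed

end

section \<open>Lattice points in the cones\<close>

text \<open>
  Generic demands are obtained by scaling the lattice points \<open>z\<close> by the number of vertices and adding
  a small perturbation: one unit at each vertex, compensated at the vertex \<open>r\<close>. The perturbation of
  the sum over a proper nonempty set of vertices is nonzero and smaller than the scaling factor, so
  it only decides how the value 0 of \<open>sum z S\<close> counts.
\<close>

definition demand :: "'a set \<Rightarrow> 'a \<Rightarrow> ('a \<Rightarrow> int) \<Rightarrow> 'a \<Rightarrow> int" where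
  "demand V r z = (\<lambda>v. int (card V) * (z v - of_bool (v = r)) + 1)"

text \<open>
  Vanishing outside \<open>V\<close> makes these functions correspond to functions on \<open>V\<close>, so that they can be
  counted.
\<close>

definition points :: "'a set \<Rightarrow> ('a \<Rightarrow> int) \<Rightarrow> nat \<Rightarrow> ('a \<Rightarrow> int) set" where
  "points V level N = {z. (\<forall>v. v \<notin> V \<longrightarrow> z v = 0) \<and> sum z V = 0 \<and> (\<Sum>v\<in>V. level v * z v) = int N}"

text \<open>
  The number of arcs of \<open>T\<close> that are directed towards the vertex \<open>r\<close>.
\<close>

definition back_arcs :: "'a \<Rightarrow> ('a \<times> 'a) set \<Rightarrow> nat" where
  "back_arcs r T = card {e \<in> T. r \<in> head_side T e}"

definition compositions :: "nat \<Rightarrow> nat \<Rightarrow> nat list set" where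
  "compositions m k = {xs. length xs = m \<and> sum_list xs = k}"

lemma sum_demand:
  assumes "finite S"
  shows "sum (demand V r z) S = int (card V) * (sum z S - of_bool (r \<in> S)) + int (card S)"
proof -
  have "(\<Sum>v\<in>S. of_bool (v = r) :: int) = (\<Sum>v\<in>S. if v = r then 1 else 0)"
    by (rule sum.cong) auto
  then have "(\<Sum>v\<in>S. of_bool (v = r) :: int) = of_bool (r \<in> S)"
    using assms by (simp add: sum.delta)
  then have "(\<Sum>v\<in>S. z v - of_bool (v = r)) = sum z S - of_bool (r \<in> S)"
    by (simp only: sum_subtractf)
  moreover have "sum (demand V r z) S = int (card V) * (\<Sum>v\<in>S. z v - of_bool (v = r)) + int (card S)"
    by (simp only: demand_def sum.distrib sum_distrib_left) simp
  ultimately show ?thesis by simp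
qed

lemma sum_demand_pos_iff:
  assumes "finite V" "S \<noteq> {}" "S \<subset> V"
  shows "0 < sum (demand V r z) S \<longleftrightarrow> of_bool (r \<in> S) \<le> sum z S" and "sum (demand V r z) S \<noteq> 0"
proof -
  have fin: "finite S" using assms(1,3) finite_subset by blast
  have c: "0 < int (card S)" "int (card S) < int (card V)"
    using fin assms(2) psubset_card_mono[OF assms(1,3)] by (simp_all add: card_gt_0_iff)
  define m where "m = sum z S - of_bool (r \<in> S)"
  have eq: "sum (demand V r z) S = int (card V) * m + int (card S)"
    using sum_demand[OF fin] by (simp add: m_def)
  have "0 \<le> int (card V) * m" if "0 \<le> m" using that by simp
  moreover have "int (card V) * m \<le> - int (card V)" if "\<not> 0 \<le> m"
    using mult_left_mono[of m "-1" "int (card V)"] that by simp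
  ultimately have "0 < sum (demand V r z) S \<longleftrightarrow> 0 \<le> m" "sum (demand V r z) S \<noteq> 0"
    unfolding eq using c by linarith+
  then show "0 < sum (demand V r z) S \<longleftrightarrow> of_bool (r \<in> S) \<le> sum z S" "sum (demand V r z) S \<noteq> 0"
    by (simp_all add: m_def)
qed

lemma generic_demand:
  assumes "finite V" "r \<in> V" "sum z V = 0"
  shows "generic V (demand V r z)"
proof -
  have "sum (demand V r z) V = 0" using sum_demand[OF assms(1)] assms(2,3) by simp
  then show ?thesis using sum_demand_pos_iff(2)[OF assms(1)] unfolding generic_def by blast
qed

lemma carries_demand_iff:
  assumes "finite V" "is_tree V T"
  shows "carries T (demand V r z) \<longleftrightarrow>
    (\<forall>e\<in>T. of_bool (r \<in> head_side T e) \<le> sum z (head_side T e))"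
  using sum_demand_pos_iff(1)[OF assms(1) head_side_proper[OF assms(2)]]
  by (simp add: carries_def)

text \<open>
  The tree flow of a lattice point determines it, and all integral flows occur. Being carried means
  that the flow is nonnegative on all arcs and at least 1 on those directed towards \<open>r\<close>. Subtracting
  these lower bounds leaves arbitrary natural numbers, and their sum is known from the level.
\<close>

lemma bij_betw_points_compositions:
  assumes V: "finite V" and T: "is_tree V T"
    and level: "is_level T level"
    and es: "distinct es" "set es = T" and N: "back_arcs r T \<le> N"
  shows "bij_betw (\<lambda>z. map (\<lambda>e. nat (sum z (head_side T e) - of_bool (r \<in> head_side T e))) es)
    {z \<in> points V level N. carries T (demand V r z)}
    (compositions (length es) (N - back_arcs r T))"
    (is "bij_betw ?\<Phi> ?Z ?C")
proof -
  let ?D = "head_side T"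
  let ?o = "\<lambda>e. of_bool (r \<in> ?D e) :: int"
  have fin: "finite T" using tree_finite[OF T V] .
  have total: "(\<Sum>e\<in>T. ?o e) = int (back_arcs r T)"
    using fin by (simp add: back_arcs_def of_bool_def sum.If_cases Int_def conj_commute)
  have carries: "carries T (demand V r z) \<longleftrightarrow> (\<forall>e\<in>T. ?o e \<le> sum z (?D e))" for z
    by (rule carries_demand_iff[OF V T])
  have sum_list: "sum_list (map g es) = sum g T" for g :: "'a \<times> 'a \<Rightarrow> nat"
    using sum_list_distinct_conv_sum_set[OF es(1)] es(2) by simp
  show ?thesis
  proof (rule bij_betw_imageI)
    show "inj_on ?\<Phi> ?Z"
    proof (rule inj_onI)
      fix z w assume z: "z \<in> ?Z" and w: "w \<in> ?Z" and "?\<Phi> z = ?\<Phi> w"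
      then have "sum z (?D e) = sum w (?D e)" if "e \<in> T" for e
        using that es(2) by (auto simp: carries map_eq_conv nat_eq_iff split: if_splits)
      then have "net_inflow (\<lambda>e. sum z (?D e)) T v = net_inflow (\<lambda>e. sum w (?D e)) T v" for v
        by (simp add: net_inflow_def)
      then have "z v = w v" for v
        using z w tree_flow[OF V T, of z v] tree_flow[OF V T, of w v]
        by (cases "v \<in> V") (auto simp: points_def)
      then show "z = w" by blast
    qed
    show "?\<Phi> ` ?Z = ?C"
    proof
      show "?\<Phi> ` ?Z \<subseteq> ?C"
      proof (rule image_subsetI)
        fix z assume z: "z \<in> ?Z"
        have "int (\<Sum>e\<in>T. nat (sum z (?D e) - ?o e)) = (\<Sum>e\<in>T. sum z (?D e) - ?o e)"
          unfolding of_nat_sum using z by (intro sum.cong) (auto simp: carries)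
        also have "\<dots> = int N - int (back_arcs r T)"
          using z level_tree_demand[OF V T level, of z]
          by (simp add: sum_subtractf total points_def)
        finally have "(\<Sum>e\<in>T. nat (sum z (?D e) - ?o e)) = N - back_arcs r T" by linarith
        then show "?\<Phi> z \<in> ?C" by (simp add: compositions_def sum_list)
      qed
      show "?C \<subseteq> ?\<Phi> ` ?Z"
      proof
        fix xs assume xs: "xs \<in> ?C"
        define g where "g e = the (map_of (zip es xs) e)" for e
        have gxs: "map g es = xs"
          using xs es(1) by (intro nth_equalityI) (auto simp: g_def compositions_def map_of_zip_nth)
        define f where "f e = int (g e) + ?o e" for e
        define z where "z v = (if v \<in> V then net_inflow f T v else 0)" for v
        have zV: "z v = net_inflow f T v" if "v \<in> V" for v using that by (simp add: z_def)
        have sum_z: "sum z S = sum (net_inflow f T) S" if "S \<subseteq> V" for S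
          using that zV by (intro sum.cong) auto
        have zD: "sum z (?D e) = f e" if "e \<in> T" for e
          using sum_z[OF head_side_subset[OF T that]] tree_flow_value[OF V T that] by simp
        have "sum z V = (\<Sum>e\<in>T. f e * (of_bool (snd e \<in> V) - of_bool (fst e \<in> V)))"
          using sum_z sum_net_inflow[OF V tree_arcs[OF T]] by simp
        also have "\<dots> = 0" using tree_arcs[OF T] by (intro sum.neutral) auto
        finally have "sum z V = 0" .
        moreover have "(\<Sum>v\<in>V. level v * z v) = int N"
        proof -
          have "sum g T = N - back_arcs r T" using xs gxs sum_list[of g] by (simp add: compositions_def)
          then have "sum f T = int N"
            using N by (simp add: f_def sum.distrib total of_nat_sum[symmetric])
          then show ?thesis using level_tree_flow[OF V T level zV] by simp
        qed
        moreover have "carries T (demand V r z)" unfolding carries by (simp add: zD f_def)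
        moreover have "\<forall>v. v \<notin> V \<longrightarrow> z v = 0" by (simp add: z_def)
        ultimately have "z \<in> ?Z" by (simp add: points_def)
        moreover have "?\<Phi> z = xs"
          unfolding gxs[symmetric] using es(2) by (intro map_cong) (auto simp: zD f_def)
        ultimately show "xs \<in> ?\<Phi> ` ?Z" by blast
      qed
    qed
  qed
qed

lemma finite_compositions: "finite (compositions m k)"
proof (rule finite_subset)
  show "compositions m k \<subseteq> {xs. set xs \<subseteq> {..k} \<and> length xs = m}"
    using member_le_sum_list by (auto simp: compositions_def)
  show "finite {xs. set xs \<subseteq> {..k} \<and> length xs = m}" by (rule finite_lists_length_eq) simp
qed

lemma
  assumes V: "finite V" "V \<noteq> {}" and T: "is_tree V T"
    and level: "is_level T level"
  shows finite_carried_points: "finite {z \<in> points V level N. carries T (demand V r z)}" (is "finite ?Z")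
    and card_carried_points: "card {z \<in> points V level N. carries T (demand V r z)} =
      (if N < back_arcs r T then 0 else card (compositions (card V - 1) (N - back_arcs r T)))"
proof -
  have fin: "finite T" using tree_finite[OF T V(1)] .
  obtain es where es: "distinct es" "set es = T" using finite_distinct_list[OF fin] by blast
  have len: "length es = card V - 1"
    using card_tree[OF V(1) T V(2)] distinct_card[OF es(1)] es(2) by simp
  have empty: "?Z = {}" if "N < back_arcs r T"
  proof (rule ccontr)
    assume "?Z \<noteq> {}"
    then obtain z where z: "z \<in> points V level N" "carries T (demand V r z)" by blast
    have "int (back_arcs r T) = (\<Sum>e\<in>T. of_bool (r \<in> head_side T e))"
      using fin by (simp add: back_arcs_def of_bool_def sum.If_cases Int_def conj_commute)
    also have "\<dots> \<le> (\<Sum>e\<in>T. sum z (head_side T e))"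
      using z(2) unfolding carries_demand_iff[OF V(1) T] by (intro sum_mono) auto
    also have "\<dots> = int N"
      using z(1) level_tree_demand[OF V(1) T level, of z] by (simp add: points_def)
    finally show False using that by simp
  qed
  note bij = bij_betw_points_compositions[OF V(1) T level es, of r N]
  have "finite ?Z \<and>
      card ?Z = (if N < back_arcs r T then 0 else card (compositions (card V - 1) (N - back_arcs r T)))"
  proof (cases "N < back_arcs r T")
    case True
    then show ?thesis unfolding empty[OF True] by simp
  next
    case False
    then show ?thesis
      using bij_betw_finite[OF bij] bij_betw_same_card[OF bij] finite_compositions len by simp
  qed
  then show "finite ?Z"
    and "card ?Z = (if N < back_arcs r T then 0 else card (compositions (card V - 1) (N - back_arcs r T)))"
    by blast+
qed

section \<open>Counting Jaeger trees\<close>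

text \<open>
  The Ehrhart series of the standard simplex with \<open>m\<close> vertices, that is, \<open>1 / (1 - X)\<^sup>m\<close>. The
  series of every cone is a multiple of it, by a power of \<open>X\<close>.
\<close>

definition composition_series :: "nat \<Rightarrow> int fps" where
  "composition_series m = Abs_fps (\<lambda>k. int (card (compositions m k)))"

lemma composition_series_nonzero: "composition_series m \<noteq> 0"
proof -
  have "replicate m 0 \<in> compositions m 0" by (simp add: compositions_def sum_list_replicate)
  then have "fps_nth (composition_series m) 0 \<noteq> 0"
    using finite_compositions by (auto simp: composition_series_def)
  then show ?thesis by auto
qed

text \<open>
  Evaluation at \<open>X = 1\<close>, written as a sum of coefficients up to a bound on the exponents.
\<close>

lemma sum_nth_fps_X_powers:
  assumes "finite S" "\<And>a. a \<in> S \<Longrightarrow> h a \<le> n"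
  shows "(\<Sum>k\<le>n. fps_nth (\<Sum>a\<in>S. fps_X ^ h a) k) = int (card S)"
proof -
  have "(\<Sum>k\<le>n. fps_nth (\<Sum>a\<in>S. fps_X ^ h a) k) = (\<Sum>k\<le>n. \<Sum>a\<in>S. if k = h a then 1 else 0 :: int)"
    by (simp add: fps_sum_nth)
  also have "\<dots> = (\<Sum>a\<in>S. \<Sum>k\<le>n. if k = h a then 1 else 0)" by (rule sum.swap)
  also have "\<dots> = (\<Sum>a\<in>S. 1)" using assms(2) by (intro sum.cong) auto
  finally show ?thesis by simp
qed

context oriented_graph
begin

text \<open>
  All spanning trees are allowed here, so this set involves neither a ribbon structure nor a basis.
\<close>

definition carried_points :: "('a \<Rightarrow> int) \<Rightarrow> 'a \<Rightarrow> nat \<Rightarrow> ('a \<Rightarrow> int) set" where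
  "carried_points level r N = {z \<in> points (pverts G) level N.
     \<exists>T. is_tree (pverts G) T \<and> T \<subseteq> parcs G \<and> carries T (demand (pverts G) r z)}"

end

context toured_graph
begin

lemma finite_jaeger_trees: "finite {T. jaeger_tree G \<sigma> b T}"
  by (rule finite_subset[of _ "Pow (parcs G)"]) (auto simp: jaeger_tree_iff pair_finite_arcs)

text \<open>
  The cones of the Jaeger trees partition the carried points, so the Ehrhart series of the whole is
  the sum of the series of the cones, and each of these is a shifted \<open>composition_series\<close>.
\<close>

lemma jaeger_series:
  assumes level: "is_level (parcs G) level" and r: "r \<in> pverts G"
  shows "(\<Sum>T | jaeger_tree G \<sigma> b T. fps_X ^ back_arcs r T) * composition_series (card (pverts G) - 1) =
    Abs_fps (\<lambda>N. int (card (carried_points level r N)))"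
proof (rule fps_ext)
  fix N
  let ?V = "pverts G" and ?J = "{T. jaeger_tree G \<sigma> b T}"
  let ?Z = "\<lambda>T. {z \<in> points ?V level N. carries T (demand ?V r z)}"
  have "?V \<noteq> {}" using r by blast
  have J: "is_tree ?V T" "is_level T level" if "T \<in> ?J" for T
    using that is_level_subset[OF level] by (auto simp: jaeger_tree_iff)
  have "carried_points level r N = (\<Union>T\<in>?J. ?Z T)"
  proof
    show "carried_points level r N \<subseteq> (\<Union>T\<in>?J. ?Z T)"
    proof
      fix z assume z: "z \<in> carried_points level r N"
      then obtain T0 where T0: "is_tree ?V T0" "T0 \<subseteq> parcs G" "carries T0 (demand ?V r z)"
        by (auto simp: carried_points_def)
      have zN: "z \<in> points ?V level N" using z by (simp add: carried_points_def)
      then have "generic ?V (demand ?V r z)"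
        using generic_demand[OF pair_finite_verts r] by (simp add: points_def)
      then obtain T where "jaeger_tree G \<sigma> b T" "carries T (demand ?V r z)"
        using jaeger_cone_exists[OF level _ T0] by blast
      then show "z \<in> (\<Union>T\<in>?J. ?Z T)" using zN by blast
    qed
    show "(\<Union>T\<in>?J. ?Z T) \<subseteq> carried_points level r N"
      by (auto simp: carried_points_def jaeger_tree_iff)
  qed
  moreover have "?Z T \<inter> ?Z T' = {}" if "T \<in> ?J" "T' \<in> ?J" "T \<noteq> T'" for T T'
  proof (rule ccontr)
    assume "?Z T \<inter> ?Z T' \<noteq> {}"
    then obtain z where "z \<in> points ?V level N" "carries T (demand ?V r z)" "carries T' (demand ?V r z)"
      by blast
    then show False
      using jaeger_cones_disjoint[of T T' "demand ?V r z"] that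
        generic_demand[OF pair_finite_verts r, of z] by (simp add: points_def generic_def)
  qed
  moreover have "finite (?Z T)" if "T \<in> ?J" for T
    using finite_carried_points[OF pair_finite_verts \<open>?V \<noteq> {}\<close> J[OF that]] by blast
  ultimately have "card (carried_points level r N) = (\<Sum>T\<in>?J. card (?Z T))"
    using card_UN_disjoint[OF finite_jaeger_trees, of ?Z] by auto
  also have "\<dots> = (\<Sum>T\<in>?J. if N < back_arcs r T then 0
      else card (compositions (card ?V - 1) (N - back_arcs r T)))"
    using card_carried_points[OF pair_finite_verts \<open>?V \<noteq> {}\<close> J] by (intro sum.cong) auto
  finally have "int (card (carried_points level r N)) = (\<Sum>T\<in>?J. if N < back_arcs r T then 0
      else fps_nth (composition_series (card ?V - 1)) (N - back_arcs r T))"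
    by (simp add: composition_series_def of_nat_sum if_distrib cong: if_cong)
  then show "fps_nth ((\<Sum>T\<in>?J. fps_X ^ back_arcs r T) * composition_series (card ?V - 1)) N =
      fps_nth (Abs_fps (\<lambda>N. int (card (carried_points level r N)))) N"
    by (simp add: sum_distrib_right fps_sum_nth fps_X_power_mult_nth del: One_nat_def)
qed

end

theorem corollary5p15:
  fixes G :: "'a pair_pre_digraph"
    and \<sigma> \<sigma>' :: "'a \<Rightarrow> 'a \<times> 'a \<Rightarrow> 'a \<times> 'a"
    and b b' :: "'a \<times> ('a \<times> 'a)"
  assumes "oriented_graph G"
    and "connected (with_proj G)"
    and "semi_balanced G"
    and "ribbon_structure G \<sigma>" and "is_basis G b"
    and "ribbon_structure G \<sigma>'" and "is_basis G b'"
  shows "card {T. jaeger_tree G \<sigma> b T} = card {T. jaeger_tree G \<sigma>' b' T}"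
proof -
  interpret oriented_graph G by fact
  interpret one: toured_graph G \<sigma> b using assms(4,5) by unfold_locales
  interpret two: toured_graph G \<sigma>' b' using assms(6,7) by unfold_locales
  obtain level where level: "is_level (parcs G) level"
    using level_function[OF assms(2,3)] by blast
  have r: "fst b \<in> pverts G" using assms(5) by (simp add: is_basis_def)
  have "(\<Sum>T | jaeger_tree G \<sigma> b T. fps_X ^ back_arcs (fst b) T) * composition_series (card (pverts G) - 1) =
      (\<Sum>T | jaeger_tree G \<sigma>' b' T. fps_X ^ back_arcs (fst b) T) * composition_series (card (pverts G) - 1)"
    using one.jaeger_series[OF level r] two.jaeger_series[OF level r] by simp
  then have "(\<Sum>T | jaeger_tree G \<sigma> b T. fps_X ^ back_arcs (fst b) T :: int fps) =
      (\<Sum>T | jaeger_tree G \<sigma>' b' T. fps_X ^ back_arcs (fst b) T)"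
    using composition_series_nonzero by simp
  \<comment> \<open>The number of arcs of \<open>G\<close> bounds all exponents that occur.\<close>
  moreover have "back_arcs (fst b) T \<le> card (parcs G)" if "T \<subseteq> parcs G" for T
    unfolding back_arcs_def using that by (intro card_mono[OF pair_finite_arcs]) auto
  ultimately show ?thesis
    using sum_nth_fps_X_powers[OF one.finite_jaeger_trees, of "back_arcs (fst b)" "card (parcs G)"]
      sum_nth_fps_X_powers[OF two.finite_jaeger_trees, of "back_arcs (fst b)" "card (parcs G)"]
    by (simp add: one.jaeger_tree_iff two.jaeger_tree_iff)
qed

end
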